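(* Let $G$ be a closed subgroup of $\mathbb{R}^d$, let $D$ be a fundamental domain of $G$, let $\nu$ be a finite Borel measure essentially supported on $D$, and let $\mu=\mu_1+\cdots+\mu_N$ be a multi-tiling measure with respect to $G$ built from $\nu$, with associated functions $g_1,\ldots,g_N$ and determinant function $\mathfrak{D}_x$. Assume that $\nu$ admits at least one Riesz spectrum contained in $G^\perp$. Let $\mathbf{t}=(t_1,\ldots,t_N)\in\mathbb{R}^{Nd}$ with each $t_k\in\mathbb{R}^d$. Then the following are equivalent: (1) There exists $\epsilon_0>0$ such that $|\mathfrak{D}_x(\mathbf{t})|\ge\epsilon_0$ for $\nu$-a.e. $x$. (2) Whenever $\Lambda\subset G^\perp$ is a frame spectrum of $\nu$, the set $\bigcup_{k=1}^N(\Lambda+t_k)$ is a frame spectrum of $\mu$. (3) Whenever $\Lambda\subset G^\perp$ is a Riesz spectrum of $\nu$, the set $\bigcup_{k=1}^N(\Lambda+t_k)$ is a Riesz spectrum of $\mu$.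
   Context: Spectra. For a countable set $\Lambda\subset\mathbb{R}^d$, $E(\Lambda)=\{e^{2\pi i\lambda\cdot x}:\lambda\in\Lambda\}$. For a finite Borel measure $\rho$ on $\mathbb{R}^d$, $\Lambda$ is a frame spectrum of $\rho$ if there are $0<A\le B<\infty$ with $A\int|f|^2d\rho\le\sum_{\lambda\in\Lambda}\left|\int f(x)e^{-2\pi i\lambda\cdot x}d\rho(x)\right|^2\le B\int|f|^2d\rho$ for all $f\in L^2(\rho)$. $\Lambda$ is a Riesz spectrum of $\rho$ if $E(\Lambda)$ is a Riesz basis for $L^2(\rho)$, i.e. $\Lambda$ is a frame spectrum and also there are $0<A\le B<\infty$ with $A\sum|c_\lambda|^2\le\int\left|\sum_{\lambda\in\Lambda}c_\lambda e^{2\pi i\lambda\cdot x}\right|^2d\rho(x)\le B\sum|c_\lambda|^2$ for all finitely supported complex families $(c_\lambda)_{\lambda\in\Lambda}$. Groups. $G$ is a closed additive subgroup of $\mathbb{R}^d$, not necessarily discrete. A fundamental domain of $G$ is a Borel subset of $\mathbb{R}^d$ containing exactly one representative of each coset in $\mathbb{R}^d/G$. The dual group is $G^\perp=\{x\in\mathbb{R}^d:x\cdot g\in\mathbb{Z}\ \forall g\in G\}$. Multi-tiling measures. An essential support of a finite Borel measure $\rho$ is a Borel set $X_\rho$ with $\rho(X_\rho)=\rho(\mathbb{R}^d)$, denoted $\mathrm{supp}(\rho)$. Let $\nu$ be a finite Borel measure with essential support contained in $D$. Let $\mu_1,\ldots,\mu_N$ be finite Borel measures such that each $\mu_k$ has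 an essential support $X_k$ contained in some fundamental domain $D_k$ of $G$. Let $\pi_k:X_k\to D$ be the injective map sending $y$ to the unique element of $D\cap(y+G)$, and assume $\mu_k=\nu\circ\pi_k$, i.e. $\mu_k(B)=\nu(\pi_k(B\cap X_k))$ for every Borel set $B$. Assume $\mathrm{supp}(\nu)\subset\pi_k(X_k)$, so that for each $x\in\mathrm{supp}(\nu)$ and each $j$ there is a unique $g_j(x)\in G$ with $x+g_j(x)\in X_j$. If moreover $\mu=\mu_1+\cdots+\mu_N$ satisfies $\mu(X_j\cap X_k)=0$ for all $j\ne k$, then $\mu$ is called the multi-tiling measure of $\mu_1,\ldots,\mu_N$ with respect to $G$. For $\mathbf{t}=(t_1,\ldots,t_N)$ with $t_k\in\mathbb{R}^d$ and $x\in\mathrm{supp}(\nu)$, $M_x(\mathbf{t})$ is the $N\times N$ matrix with entries $(M_x(\mathbf{t}))_{j,k}=e^{2\pi i t_k\cdot g_j(x)}$, and $\mathfrak{D}_x(\mathbf{t})=\det M_x(\mathbf{t})$. *)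

theory Defs
  imports "HOL-Analysis.Analysis"
begin

definition closed_additive_subgroup :: "(real ^ 'd) set \<Rightarrow> bool" where
  "closed_additive_subgroup G \<longleftrightarrow>
     closed G \<and> 0 \<in> G \<and> (\<forall>x\<in>G. \<forall>y\<in>G. x + y \<in> G) \<and> (\<forall>x\<in>G. - x \<in> G)"

definition fundamental_domain :: "(real ^ 'd) set \<Rightarrow> (real ^ 'd) set \<Rightarrow> bool" where
  "fundamental_domain G D \<longleftrightarrow>
     D \<in> sets borel \<and> (\<forall>x. \<exists>!y. y \<in> D \<inter> (+) x ` G)"

definition dual_group :: "(real ^ 'd) set \<Rightarrow> (real ^ 'd) set" where
  "dual_group G = {x. \<forall>g\<in>G. x \<bullet> g \<in> \<int>}"

definition finite_borel_measure :: "(real ^ 'd) measure \<Rightarrow> bool" where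
  "finite_borel_measure \<rho> \<longleftrightarrow> sets \<rho> = sets borel \<and> finite_measure \<rho>"

definition essential_support :: "(real ^ 'd) measure \<Rightarrow> (real ^ 'd) set \<Rightarrow> bool" where
  "essential_support \<rho> X \<longleftrightarrow> X \<in> sets borel \<and> emeasure \<rho> X = emeasure \<rho> UNIV"

definition character :: "real ^ 'd \<Rightarrow> real ^ 'd \<Rightarrow> complex" where
  "character l x = exp (2 * of_real pi * \<i> * of_real (l \<bullet> x))"

definition square_integrable :: "(real ^ 'd) measure \<Rightarrow> (real ^ 'd \<Rightarrow> complex) \<Rightarrow> bool" where
  "square_integrable \<rho> f \<longleftrightarrow>
     f \<in> borel_measurable \<rho> \<and> integrable \<rho> (\<lambda>x. (cmod (f x))\<^sup>2)"

definition fourier_coeff ::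
  "(real ^ 'd) measure \<Rightarrow> (real ^ 'd \<Rightarrow> complex) \<Rightarrow> real ^ 'd \<Rightarrow> complex" where
  "fourier_coeff \<rho> f l = (LINT x|\<rho>. f x * character (- l) x)"

text \<open>
  The conjunct \<open>summable_on\<close> says that the sum of nonnegative terms is finite, which is
  part of the upper frame inequality; without it the real-valued \<open>infsum\<close> of a divergent
  family would be 0.
\<close>

definition frame_spectrum :: "(real ^ 'd) measure \<Rightarrow> (real ^ 'd) set \<Rightarrow> bool" where
  "frame_spectrum \<rho> \<Lambda> \<longleftrightarrow>
     countable \<Lambda> \<and>
     (\<exists>A B. 0 < A \<and> A \<le> B \<and>
        (\<forall>f. square_integrable \<rho> f \<longrightarrow>
           (\<lambda>l. (cmod (fourier_coeff \<rho> f l))\<^sup>2) summable_on \<Lambda> \<and>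
           A * (LINT x|\<rho>. (cmod (f x))\<^sup>2)
             \<le> (\<Sum>\<^sub>\<infinity>l\<in>\<Lambda>. (cmod (fourier_coeff \<rho> f l))\<^sup>2) \<and>
           (\<Sum>\<^sub>\<infinity>l\<in>\<Lambda>. (cmod (fourier_coeff \<rho> f l))\<^sup>2)
             \<le> B * (LINT x|\<rho>. (cmod (f x))\<^sup>2)))"

definition riesz_spectrum :: "(real ^ 'd) measure \<Rightarrow> (real ^ 'd) set \<Rightarrow> bool" where
  "riesz_spectrum \<rho> \<Lambda> \<longleftrightarrow>
     frame_spectrum \<rho> \<Lambda> \<and>
     (\<exists>A B. 0 < A \<and> A \<le> B \<and>
        (\<forall>F c. finite F \<and> F \<subseteq> \<Lambda> \<longrightarrow>
           A * (\<Sum>l\<in>F. (cmod (c l))\<^sup>2)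
             \<le> (LINT x|\<rho>. (cmod (\<Sum>l\<in>F. c l * character l x))\<^sup>2) \<and>
           (LINT x|\<rho>. (cmod (\<Sum>l\<in>F. c l * character l x))\<^sup>2)
             \<le> B * (\<Sum>l\<in>F. (cmod (c l))\<^sup>2)))"

text \<open>The map \<open>\<pi>\<^sub>k\<close> is the restriction of \<open>coset_rep G D\<close> to \<open>X\<^sub>k\<close>.\<close>

definition coset_rep :: "(real ^ 'd) set \<Rightarrow> (real ^ 'd) set \<Rightarrow> real ^ 'd \<Rightarrow> real ^ 'd" where
  "coset_rep G D y = (THE z. z \<in> D \<inter> (+) y ` G)"

text \<open>
  \<open>S\<close> is the essential support of \<open>\<nu>\<close> and \<open>X k\<close> that of \<open>\<mu>s k\<close>; \<open>\<mu>\<close> is the sum of the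
  \<open>\<mu>s k\<close>.  The images \<open>coset_rep G D ` (B \<inter> X k)\<close> are automatically Borel (injective images
  under a map with Borel graph), so no measurability condition is imposed on them.
\<close>

definition multi_tiling_measure ::
  "(real ^ 'd) set \<Rightarrow> (real ^ 'd) set \<Rightarrow> (real ^ 'd) measure \<Rightarrow> (real ^ 'd) set \<Rightarrow>
   ('n::finite \<Rightarrow> (real ^ 'd) measure) \<Rightarrow> ('n \<Rightarrow> (real ^ 'd) set) \<Rightarrow>
   (real ^ 'd) measure \<Rightarrow> bool" where
  "multi_tiling_measure G D \<nu> S \<mu>s X \<mu> \<longleftrightarrow>
     (\<forall>k. finite_borel_measure (\<mu>s k) \<and>
          essential_support (\<mu>s k) (X k) \<and>
          (\<exists>Dk. fundamental_domain G Dk \<and> X k \<subseteq> Dk) \<and>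
          (\<forall>B\<in>sets borel. emeasure (\<mu>s k) B = emeasure \<nu> (coset_rep G D ` (B \<inter> X k))) \<and>
          S \<subseteq> coset_rep G D ` X k) \<and>
     sets \<mu> = sets borel \<and>
     (\<forall>B\<in>sets borel. emeasure \<mu> B = (\<Sum>k\<in>UNIV. emeasure (\<mu>s k) B)) \<and>
     (\<forall>j k. j \<noteq> k \<longrightarrow> emeasure \<mu> (X j \<inter> X k) = 0)"

text \<open>
  \<open>tiling_shift G (X j) x\<close> is \<open>g\<^sub>j(x)\<close>.  For a multi-tiling measure it is uniquely determined
  when \<open>x\<close> lies in the essential support of \<open>\<nu>\<close>; elsewhere, hence on a \<open>\<nu>\<close>-null set, its
  value is unspecified.
\<close>

definition tiling_shift :: "(real ^ 'd) set \<Rightarrow> (real ^ 'd) set \<Rightarrow> real ^ 'd \<Rightarrow> real ^ 'd" where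
  "tiling_shift G Y x = (THE g. g \<in> G \<and> x + g \<in> Y)"

definition tiling_matrix ::
  "(real ^ 'd) set \<Rightarrow> ('n::finite \<Rightarrow> (real ^ 'd) set) \<Rightarrow> ('n \<Rightarrow> real ^ 'd) \<Rightarrow> real ^ 'd \<Rightarrow>
   complex ^ 'n ^ 'n" where
  "tiling_matrix G X t x = (\<chi> j k. character (t k) (tiling_shift G (X j) x))"

definition tiling_det ::
  "(real ^ 'd) set \<Rightarrow> ('n::finite \<Rightarrow> (real ^ 'd) set) \<Rightarrow> ('n \<Rightarrow> real ^ 'd) \<Rightarrow> real ^ 'd \<Rightarrow>
   complex" where
  "tiling_det G X t x = det (tiling_matrix G X t x)"

definition translates_union ::
  "('n::finite \<Rightarrow> real ^ 'd) \<Rightarrow> (real ^ 'd) set \<Rightarrow> (real ^ 'd) set" where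
  "translates_union t \<Lambda> = (\<Union>k. (\<lambda>l. l + t k) ` \<Lambda>)"

end

theory Submission
  imports Defs
begin

text \<open>
  The idea is to view a function on the \<open>N\<close> sheets of \<open>\<mu>\<close> as a vector-valued function on the base.  Let
  \<open>place k x\<close> be the point of sheet \<open>k\<close> over \<open>x\<close>.  Then \<open>\<mu>\<close> is the sum of the images of \<open>\<nu>\<close> under the maps
  \<open>place k\<close>, and \<open>f \<mapsto> fibre f\<close> is an isometry of \<open>L\<^sup>2(\<mu>)\<close> into \<open>L\<^sup>2(\<nu>; \<complex>\<^sup>N)\<close>; it reaches every field of the
  form \<open>1\<^sub>E v\<close> because the sheets are disjoint up to null sets.

  Characters with frequency in the dual group are constant along cosets of \<open>G\<close>.  Hence the Fourier
  coefficient of \<open>f\<close> at \<open>l + t k\<close> is the coefficient at \<open>l\<close> of component \<open>k\<close> of the field obtained from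
  \<open>fibre f\<close> by the adjoint of the matrix \<open>phase t x\<close> (lemma \<open>fourier_coeff_translate\<close>).  This matrix
  is the tiling matrix up to unimodular column factors.  If \<open>\<Lambda>\<close> is a frame spectrum of \<open>\<nu>\<close>, the frame
  sums over the translates of \<open>\<Lambda>\<close>, added up over \<open>k\<close>, are therefore comparable
  to the squared norm of this field.  Dually, a
  trigonometric polynomial with frequencies in the translates restricts to the fibres as the phase
  matrix applied to polynomials with frequencies in \<open>\<Lambda>\<close>.

  So everything turns on whether the phase matrices are bounded below uniformly in \<open>x\<close>.  As their
  entries are unimodular, this is the case exactly if their determinants are bounded away from 0
  (\<open>det_times_norm_le\<close>, \<open>det_lower_bound\<close>).  The determinant bound then gives the frame and the Riesz
  property (\<open>frame_spectrum_translates\<close>, \<open>riesz_spectrum_translates\<close>); it also forces the translates to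
  be disjoint unless \<open>\<nu> = 0\<close>.  Conversely, the frame property for a single \<open>\<Lambda>\<close> already implies the
  determinant bound (\<open>det_bound_of_frame_spectrum\<close>).  The assumed Riesz spectrum of \<open>\<nu>\<close>, which is also
  a frame spectrum, serves as this \<open>\<Lambda>\<close> in both converse implications.

  The delicate point is measurability.  If \<open>G\<close> is not discrete, it is not clear that the choice of coset
  representatives in a Borel fundamental domain is a Borel map, nor that the images of Borel sets in the
  definition of a multi-tiling measure are Borel.  Both follow from a version of Lusin's
  separation theorem (\<open>borel_separated_saturation\<close>) for saturations of Borel sets by \<open>G\<close>, where
  compactness of the sets in a Souslin scheme replaces any structure theory of closed subgroups.
\<close>

section \<open>Souslin sets in Euclidean space\<close>

text \<open>
  Sets obtained by the Souslin operation from compact sets; in Euclidean space these are the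
  analytic sets.  The locality condition says that \<open>F x n\<close> depends only on the first \<open>n + 1\<close> entries of
  the branch \<open>x\<close>.  Branches are total sequences, not finite words, so that schemes can be combined by
  recoding sequences.
\<close>
definition souslin :: "'a::topological_space set \<Rightarrow> bool" where
  "souslin A \<longleftrightarrow> (\<exists>F :: (nat \<Rightarrow> nat) \<Rightarrow> nat \<Rightarrow> 'a set.
     (\<forall>x n. compact (F x n)) \<and>
     (\<forall>x y n. (\<forall>i\<le>n. x i = y i) \<longrightarrow> F x n = F y n) \<and>
     A = (\<Union>x. \<Inter>n. F x n))"

lemma souslinI:
  fixes F :: "(nat \<Rightarrow> nat) \<Rightarrow> nat \<Rightarrow> 'a::topological_space set"
  assumes "\<And>x n. compact (F x n)"
    and "\<And>x y n. (\<And>i. i \<le> n \<Longrightarrow> x i = y i) \<Longrightarrow> F x n = F y n"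
    and "A = (\<Union>x. \<Inter>n. F x n)"
  shows "souslin A"
  unfolding souslin_def by (intro exI[of _ F] conjI allI impI assms) auto

lemma souslinE:
  assumes "souslin A"
  obtains F where "\<forall>x n. compact (F x n)"
    and "\<forall>x y n. (\<forall>i\<le>n. x i = y i) \<longrightarrow> F x n = F y n"
    and "A = (\<Union>x::nat \<Rightarrow> nat. \<Inter>n. F x n)"
  using assms unfolding souslin_def by blast

lemma souslin_compact: "compact A \<Longrightarrow> souslin A"
  by (rule souslinI[of "\<lambda>_ _. A"]) auto

text \<open>
  The entry \<open>x 0\<close> of a branch of the combined scheme codes both the index of the chosen set and the
  first entry of a branch in its scheme.  Hence already stage 0 knows the index, as locality requires.
\<close>
lemma souslin_UN:
  fixes A :: "nat \<Rightarrow> 'a::topological_space set"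
  assumes "\<And>i. souslin (A i)"
  shows "souslin (\<Union>i. A i)"
proof -
  have "\<forall>i. \<exists>F. (\<forall>x n. compact (F x n)) \<and>
     (\<forall>x y n. (\<forall>i\<le>n. x i = y i) \<longrightarrow> F x n = F y n) \<and> A i = (\<Union>x::nat\<Rightarrow>nat. \<Inter>n. F x n)"
    using assms unfolding souslin_def by blast
  then obtain F where comp: "\<And>i x n. compact (F i x n)"
    and loc: "\<And>i x y n. (\<And>j. j \<le> n \<Longrightarrow> x j = y j) \<Longrightarrow> F i x n = F i y n"
    and A: "\<And>i. A i = (\<Union>x::nat\<Rightarrow>nat. \<Inter>n. F i x n)"
    by metis
  define H where "H x n = F (fst (prod_decode (x 0))) (x(0 := snd (prod_decode (x 0)))) n" for x n
  show ?thesis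
  proof (rule souslinI[of H])
    show "compact (H x n)" for x n
      by (simp add: H_def comp)
    show "H x n = H y n" if "\<And>i. i \<le> n \<Longrightarrow> x i = y i" for x y n
    proof -
      have "x 0 = y 0" using that by simp
      then show ?thesis unfolding H_def by (auto intro!: loc that)
    qed
    have "\<exists>z. \<forall>n. H z n = F i x n" for i x
    proof -
      have "(x(0 := prod_encode (i, x 0)))(0 := x 0) = x" by auto
      then show ?thesis
        by (intro exI[of _ "x(0 := prod_encode (i, x 0))"]) (simp add: H_def)
    qed
    then show "(\<Union>i. A i) = (\<Union>x. \<Inter>n. H x n)"
      unfolding A set_eq_iff UN_iff INT_iff by (metis H_def UNIV_I)
  qed
qed

lemma prod_encode_mono_right: "i \<le> k \<Longrightarrow> prod_encode (n, i) \<le> prod_encode (n, k)"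
proof (induction k rule: dec_induct)
  case (step k)
  have "prod_encode (n, k) \<le> prod_encode (n, Suc k)"
    by (simp add: prod_encode_def)
  with step show ?case by simp
qed simp

text \<open>
  One branch of the combined scheme interleaves branches of all the given schemes along the pairing
  function, and its stage \<open>prod_encode (n, k)\<close> is stage \<open>k\<close> of scheme \<open>n\<close>.  Locality survives because the
  pairing function increases in its second argument.
\<close>
lemma souslin_INT:
  fixes A :: "nat \<Rightarrow> 'a::topological_space set"
  assumes "\<And>i. souslin (A i)"
  shows "souslin (\<Inter>i. A i)"
proof -
  have "\<forall>i. \<exists>F. (\<forall>x n. compact (F x n)) \<and>
     (\<forall>x y n. (\<forall>i\<le>n. x i = y i) \<longrightarrow> F x n = F y n) \<and> A i = (\<Union>x::nat\<Rightarrow>nat. \<Inter>n. F x n)"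
    using assms unfolding souslin_def by blast
  then obtain F where comp: "\<And>i x n. compact (F i x n)"
    and loc: "\<And>i x y n. (\<And>j. j \<le> n \<Longrightarrow> x j = y j) \<Longrightarrow> F i x n = F i y n"
    and A: "\<And>i. A i = (\<Union>x::nat\<Rightarrow>nat. \<Inter>n. F i x n)"
    by metis
  define H where "H x m = (case prod_decode m of (n, k) \<Rightarrow> F n (\<lambda>i. x (prod_encode (n, i))) k)"
    for x m
  have H: "H x (prod_encode (n, k)) = F n (\<lambda>i. x (prod_encode (n, i))) k" for x n k
    by (simp add: H_def)
  have all_H: "(\<forall>m. a \<in> H x m) \<longleftrightarrow> (\<forall>n k. a \<in> F n (\<lambda>i. x (prod_encode (n, i))) k)" for a x
    by (metis H prod_decode_inverse surj_pair)
  show ?thesis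
  proof (rule souslinI[of H])
    show "compact (H x n)" for x n
      by (simp add: H_def comp split: prod.split)
    show "H x m = H y m" if "\<And>i. i \<le> m \<Longrightarrow> x i = y i" for x y m
    proof -
      obtain n k where m: "m = prod_encode (n, k)" by (metis prod_decode_inverse surj_pair)
      show ?thesis unfolding m H
        by (intro loc that) (simp add: m prod_encode_mono_right)
    qed
    show "(\<Inter>i. A i) = (\<Union>x. \<Inter>m. H x m)"
    proof (intro set_eqI iffI)
      fix a assume "a \<in> (\<Inter>i. A i)"
      then have "\<forall>i. \<exists>x. \<forall>k. a \<in> F i x k" by (auto simp: A)
      then obtain x where x: "\<And>i k. a \<in> F i (x i) k" by metis
      define z where "z m = (case prod_decode m of (n, i) \<Rightarrow> x n i)" for m
      have "\<forall>m. a \<in> H z m" unfolding all_H by (simp add: z_def x)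
      then show "a \<in> (\<Union>x. \<Inter>m. H x m)" by blast
    next
      fix a assume "a \<in> (\<Union>x. \<Inter>m. H x m)"
      then obtain x where "\<forall>m. a \<in> H x m" by blast
      then show "a \<in> (\<Inter>i. A i)" unfolding all_H A by blast
    qed
  qed
qed

lemma souslin_closed:
  fixes A :: "'a::euclidean_space set"
  assumes "closed A"
  shows "souslin A"
proof -
  have "A = (\<Union>n. A \<inter> cball 0 (real n))"
    by (auto simp: real_arch_simple)
  moreover have "souslin (\<Union>n. A \<inter> cball 0 (real n))"
    by (intro souslin_UN souslin_compact) (simp add: assms closed_Int_compact)
  ultimately show ?thesis by simp
qed

lemma souslin_open:
  fixes A :: "'a::euclidean_space set"
  assumes "open A"
  shows "souslin A"
proof -
  obtain \<C> where \<C>: "countable \<C>" "\<And>C. C \<in> \<C> \<Longrightarrow> closed C" "\<Union>\<C> = A"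
    using open_countable_Union_open_cbox[OF assms] by (metis closed_cbox)
  show ?thesis
  proof (cases "\<C> = {}")
    case True
    then show ?thesis using \<C> by (auto intro: souslin_compact)
  next
    case False
    then have "A = (\<Union>n. from_nat_into \<C> n)"
      using \<C> by (metis range_from_nat_into)
    moreover have "souslin (\<Union>n. from_nat_into \<C> n)"
      by (intro souslin_UN souslin_closed \<C> from_nat_into False)
    ultimately show ?thesis by simp
  qed
qed

text \<open>
  The sets that are Souslin together with their complements form a \<open>\<sigma>\<close>-algebra containing the
  open sets.
\<close>
lemma souslin_borel:
  fixes A :: "'a::euclidean_space set"
  assumes "A \<in> sets borel"
  shows "souslin A"
proof -
  have "A \<in> sigma_sets UNIV (Collect open)"
    using assms by (simp add: borel_def)
  then have "souslin A \<and> souslin (- A)"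
  proof (induction rule: sigma_sets.induct)
    case (Basic a)
    then show ?case by (simp add: souslin_open souslin_closed closed_Compl)
  next
    case Empty
    show ?case by (simp add: souslin_closed)
  next
    case (Compl a)
    then show ?case by (simp add: Compl_eq_Diff_UNIV[symmetric])
  next
    case (Union a)
    then show ?case by (auto simp: Compl_UN intro: souslin_UN souslin_INT)
  qed
  then show ?thesis ..
qed

section \<open>Saturation by a closed subgroup and Borel separation\<close>

definition saturation :: "'a::real_normed_vector set \<Rightarrow> 'a set \<Rightarrow> 'a set" where
  "saturation G A = (\<Union>x\<in>A. (+) x ` G)"

lemma mem_saturation_iff: "y \<in> saturation G A \<longleftrightarrow> (\<exists>x\<in>A. y - x \<in> G)"
  unfolding saturation_def by (force simp: image_iff algebra_simps)

definition borel_separated :: "'a::topological_space set \<Rightarrow> 'a set \<Rightarrow> bool" where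
  "borel_separated P Q \<longleftrightarrow> (\<exists>C\<in>sets borel. P \<subseteq> C \<and> Q \<inter> C = {})"

text \<open>
  Read contrapositively, this drives the separation argument: two unions that no Borel set separates
  contain a pair of pieces that no Borel set separates.
\<close>
lemma borel_separated_UN:
  assumes "\<And>m n. borel_separated (P m) (Q n)"
  shows "borel_separated (\<Union>m::nat. P m) (\<Union>n::nat. Q n)"
proof -
  obtain C where C: "\<And>m n. C m n \<in> sets borel" "\<And>m n. P m \<subseteq> C m n" "\<And>m n. Q n \<inter> C m n = {}"
    using assms unfolding borel_separated_def by metis
  show ?thesis unfolding borel_separated_def
  proof (intro bexI conjI)
    show "(\<Union>m. \<Inter>n. C m n) \<in> sets borel" using C(1) by auto
    show "(\<Union>m. P m) \<subseteq> (\<Union>m. \<Inter>n. C m n)" using C(2) by blast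
    show "(\<Union>n. Q n) \<inter> (\<Union>m. \<Inter>n. C m n) = {}" using C(3) by blast
  qed
qed

lemma closed_saturation_compact:
  fixes G K :: "'a::euclidean_space set"
  assumes "closed G" "compact K"
  shows "closed (saturation G K)"
proof -
  have "saturation G K = (\<Union>x\<in>K. \<Union>y\<in>G. {x + y})"
    by (auto simp: saturation_def)
  then show ?thesis
    using compact_closed_sums[OF assms(2,1)] by simp
qed

text \<open>
  Lusin's separation theorem for saturations.  If separation fails, it fails along a branch \<open>x\<close> of the
  scheme of \<open>A\<close> and a branch \<open>y\<close> of the scheme of \<open>B\<close>, at every stage.  At a finite stage the two
  pieces lie in saturations of compact sets.  Such saturations are closed, hence Borel, so they must
  meet.  By compactness they meet in the limit, which gives points of \<open>A\<close> and \<open>B\<close> in the same coset.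
\<close>
lemma borel_separated_saturation:
  fixes G A B :: "(real ^ 'd) set"
  assumes G: "closed_additive_subgroup G" and A: "souslin A" and B: "souslin B"
    and disj: "saturation G A \<inter> saturation G B = {}"
  shows "borel_separated (saturation G A) (saturation G B)"
proof (rule ccontr)
  assume nsep: "\<not> ?thesis"
  have closed_G: "closed G" and zero_G: "0 \<in> G"
    and diff_G: "\<And>a b. a \<in> G \<Longrightarrow> b \<in> G \<Longrightarrow> a - b \<in> G"
    using G unfolding closed_additive_subgroup_def by (auto simp: diff_conv_add_uminus simp del: add_uminus_conv_diff)
  obtain F where F: "\<forall>x n. compact (F x n)"
    "\<forall>x y n. (\<forall>i\<le>n. x i = y i) \<longrightarrow> F x n = F y n" "A = (\<Union>x::nat \<Rightarrow> nat. \<Inter>n. F x n)"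
    by (rule souslinE[OF A])
  obtain H where H: "\<forall>x n. compact (H x n)"
    "\<forall>x y n. (\<forall>i\<le>n. x i = y i) \<longrightarrow> H x n = H y n" "B = (\<Union>x::nat \<Rightarrow> nat. \<Inter>n. H x n)"
    by (rule souslinE[OF B])
  \<comment> \<open>The parts of \<open>A\<close> and \<open>B\<close> reached by branches that begin with the first \<open>n\<close> entries of \<open>x\<close>.\<close>
  define P where "P x n = saturation G (\<Union>y\<in>{y. \<forall>i<n. y i = x i}. \<Inter>m. F y m)"
    for x :: "nat \<Rightarrow> nat" and n
  define Q where "Q x n = saturation G (\<Union>y\<in>{y. \<forall>i<n. y i = x i}. \<Inter>m. H y m)"
    for x :: "nat \<Rightarrow> nat" and n
  have split: "(\<Union>y\<in>{y. \<forall>i<n. y i = x i}. R y) = (\<Union>a. \<Union>y\<in>{y. \<forall>i<Suc n. y i = (x(n := a)) i}. R y)"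
    for R :: "(nat \<Rightarrow> nat) \<Rightarrow> (real ^ 'd) set" and x n
  proof -
    have "{y. \<forall>i<n. y i = x i} = (\<Union>a. {y. \<forall>i<Suc n. y i = (x(n := a)) i})"
      by (auto simp: less_Suc_eq)
    then show ?thesis by simp
  qed
  have sat_UN: "saturation G (\<Union>a. R a) = (\<Union>a. saturation G (R a))" for R :: "nat \<Rightarrow> (real ^ 'd) set"
    by (auto simp: saturation_def)
  have P_split: "P x n = (\<Union>a. P (x(n := a)) (Suc n))" for x n
    unfolding P_def by (subst split) (rule sat_UN)
  have Q_split: "Q x n = (\<Union>a. Q (x(n := a)) (Suc n))" for x n
    unfolding Q_def by (subst split) (rule sat_UN)
  have "\<exists>s. \<forall>n. \<not> borel_separated (P (fst (s n)) n) (Q (snd (s n)) n) \<and>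
      (\<forall>i<n. fst (s (Suc n)) i = fst (s n) i \<and> snd (s (Suc n)) i = snd (s n) i)"
  proof (rule dependent_nat_choice)
    have "P undefined 0 = saturation G A" "Q undefined 0 = saturation G B"
      by (simp_all add: P_def Q_def F(3) H(3))
    then show "\<exists>s. \<not> borel_separated (P (fst s) 0) (Q (snd s) 0)"
      using nsep by (intro exI[of _ "(undefined, undefined)"]) simp
  next
    fix s n assume "\<not> borel_separated (P (fst s) n) (Q (snd s) n)"
    then obtain a b where
      "\<not> borel_separated (P ((fst s)(n := a)) (Suc n)) (Q ((snd s)(n := b)) (Suc n))"
      using borel_separated_UN P_split Q_split by metis
    then show "\<exists>s'. \<not> borel_separated (P (fst s') (Suc n)) (Q (snd s') (Suc n)) \<and>
        (\<forall>i<n. fst s' i = fst s i \<and> snd s' i = snd s i)"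
      by (intro exI[of _ "((fst s)(n := a), (snd s)(n := b))"]) auto
  qed
  then obtain s where s: "\<And>n. \<not> borel_separated (P (fst (s n)) n) (Q (snd (s n)) n)"
    and s_Suc: "\<And>n i. i < n \<Longrightarrow> fst (s (Suc n)) i = fst (s n) i \<and> snd (s (Suc n)) i = snd (s n) i"
    by blast
  define x where "x i = fst (s (Suc i)) i" for i
  define y where "y i = snd (s (Suc i)) i" for i
  have stable: "fst (s n) i = x i \<and> snd (s n) i = y i" if "i < n" for n i
    using that
  proof (induction n)
    case (Suc n)
    then show ?case
      by (cases "i = n") (auto simp: x_def y_def s_Suc)
  qed simp
  define K where "K n = (\<Inter>m\<le>n. F x m)" for n
  define L where "L n = (\<Inter>m\<le>n. H y m)" for n
  have PK: "P (fst (s (Suc n))) (Suc n) \<subseteq> saturation G (K n)" for n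
  proof -
    have "F z m = F x m" if "\<forall>i<Suc n. z i = fst (s (Suc n)) i" "m \<le> n" for z m
      using that stable by (intro F(2)[rule_format]) auto
    then show ?thesis unfolding P_def K_def saturation_def by blast
  qed
  have QL: "Q (snd (s (Suc n))) (Suc n) \<subseteq> saturation G (L n)" for n
  proof -
    have "H z m = H y m" if "\<forall>i<Suc n. z i = snd (s (Suc n)) i" "m \<le> n" for z m
      using that stable by (intro H(2)[rule_format]) auto
    then show ?thesis unfolding Q_def L_def saturation_def by blast
  qed
  have compK: "compact (K n)" for n
    unfolding K_def by (intro compact_Inter) (auto simp: F(1)[rule_format])
  have compL: "compact (L n)" for n
    unfolding L_def by (intro compact_Inter) (auto simp: H(1)[rule_format])
  have meet: "saturation G (K n) \<inter> saturation G (L n) \<noteq> {}" for n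
  proof
    assume "saturation G (K n) \<inter> saturation G (L n) = {}"
    then have "borel_separated (P (fst (s (Suc n))) (Suc n)) (Q (snd (s (Suc n))) (Suc n))"
      unfolding borel_separated_def using PK[of n] QL[of n]
        closed_saturation_compact[OF closed_G compK[of n]] by (intro bexI[of _ "saturation G (K n)"]) auto
    with s show False by blast
  qed
  \<comment> \<open>Two saturations meet exactly when some difference of points lies in the closed set \<open>G\<close>;
    unlike the common point of the saturations, the pair of points ranges over a compact set.\<close>
  define T where "T n = (K n \<times> L n) \<inter> {p. fst p - snd p \<in> G}" for n
  have closed_diff: "closed {p :: (real ^ 'd) \<times> (real ^ 'd). fst p - snd p \<in> G}"
    using closed_vimage[OF closed_G, of "\<lambda>p. fst p - snd p"]
    by (simp add: vimage_def continuous_intros)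
  have "compact (T n)" for n
    unfolding T_def by (intro compact_Int_closed compact_Times compK compL closed_diff)
  moreover have "T n \<noteq> {}" for n
  proof -
    obtain z k l where "k \<in> K n" "l \<in> L n" "z - k \<in> G" "z - l \<in> G"
      using meet[of n] by (auto simp: mem_saturation_iff)
    moreover from this have "k - l \<in> G" using diff_G[of "z - l" "z - k"] by simp
    ultimately have "(k, l) \<in> T n" by (simp add: T_def)
    then show ?thesis by blast
  qed
  moreover have "T n \<subseteq> T m" if "m \<le> n" for m n
    using that unfolding T_def K_def L_def by (auto simp: Ball_def)
  ultimately have "\<Inter>(range T) \<noteq> {}" by (rule compact_nest)
  then obtain k l where kl: "\<And>n. (k, l) \<in> T n" by fastforce
  have "k \<in> A" using kl unfolding T_def K_def F(3) by blast
  moreover have "l \<in> B" using kl unfolding T_def L_def H(3) by blast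
  moreover have "k - l \<in> G" using kl by (simp add: T_def)
  ultimately have "k \<in> saturation G A \<inter> saturation G B"
    using zero_G unfolding Int_iff mem_saturation_iff by (metis diff_self)
  then show False using disj by blast
qed

section \<open>Measurability of the choice of coset representatives\<close>

lemma mem_coset_iff:
  assumes "closed_additive_subgroup G"
  shows "d \<in> (+) y ` G \<longleftrightarrow> y - d \<in> G"
proof
  assume "d \<in> (+) y ` G"
  then obtain g where "g \<in> G" "d = y + g" by auto
  then show "y - d \<in> G" using assms by (simp add: closed_additive_subgroup_def)
next
  assume "y - d \<in> G"
  then have "- (y - d) \<in> G" using assms unfolding closed_additive_subgroup_def by blast
  then show "d \<in> (+) y ` G" by (intro image_eqI[of _ _ "- (y - d)"]) auto
qed

lemma ex1_coset_rep:
  assumes "closed_additive_subgroup G" "fundamental_domain G D"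
  shows "\<exists>!d. d \<in> D \<and> y - d \<in> G"
proof -
  have "\<exists>!d. d \<in> D \<inter> (+) y ` G"
    using assms(2) unfolding fundamental_domain_def by blast
  then show ?thesis unfolding Int_iff mem_coset_iff[OF assms(1)] .
qed

lemma coset_rep_unfold:
  assumes "closed_additive_subgroup G"
  shows "coset_rep G D y = (THE d. d \<in> D \<and> y - d \<in> G)"
  unfolding coset_rep_def Int_iff mem_coset_iff[OF assms] ..

lemma coset_rep_mem:
  assumes "closed_additive_subgroup G" "fundamental_domain G D"
  shows "coset_rep G D y \<in> D" "y - coset_rep G D y \<in> G"
  using theI'[OF ex1_coset_rep[OF assms, of y]] by (simp_all add: coset_rep_unfold[OF assms(1)])

lemma coset_rep_eqI:
  assumes "closed_additive_subgroup G" "fundamental_domain G D" "d \<in> D" "y - d \<in> G"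
  shows "coset_rep G D y = d"
  using ex1_coset_rep[OF assms(1,2), of y] coset_rep_mem[OF assms(1,2), of y] assms(3,4) by blast

text \<open>
  The saturations of \<open>A\<close> and \<open>D - A\<close> partition the space, so a Borel set that separates them equals the
  saturation of \<open>A\<close>.  Only separation makes this work when \<open>G\<close> is uncountable: the saturation is then an
  uncountable union of translates of \<open>A\<close>.
\<close>
lemma saturation_borel:
  assumes G: "closed_additive_subgroup G" and D: "fundamental_domain G D"
    and A: "A \<in> sets borel" "A \<subseteq> D"
  shows "saturation G A \<in> sets borel"
proof -
  have sat: "y \<in> saturation G B \<longleftrightarrow> coset_rep G D y \<in> B" if "B \<subseteq> D" for y B
    using that coset_rep_mem[OF G D, of y] coset_rep_eqI[OF G D, of _ y]
    unfolding mem_saturation_iff by blast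
  have "D - A \<in> sets borel"
    using D A by (auto simp: fundamental_domain_def)
  moreover have "saturation G A \<inter> saturation G (D - A) = {}"
    using A(2) by (auto simp: sat)
  ultimately have "borel_separated (saturation G A) (saturation G (D - A))"
    by (intro borel_separated_saturation G souslin_borel A)
  then obtain C where "C \<in> sets borel" "saturation G A \<subseteq> C" "saturation G (D - A) \<inter> C = {}"
    unfolding borel_separated_def by blast
  moreover have "saturation G A \<union> saturation G (D - A) = UNIV"
    using A(2) coset_rep_mem[OF G D] by (auto simp: sat)
  ultimately have "saturation G A = C" by blast
  then show ?thesis using \<open>C \<in> sets borel\<close> by simp
qed

lemma coset_rep_measurable:
  assumes G: "closed_additive_subgroup G" and D: "fundamental_domain G D"
  shows "coset_rep G D \<in> borel_measurable borel"
proof (rule measurableI)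
  fix B :: "(real ^ 'a) set" assume B: "B \<in> sets borel"
  have "coset_rep G D -` B = saturation G (B \<inter> D)"
    using coset_rep_mem[OF G D] coset_rep_eqI[OF G D] by (force simp: mem_saturation_iff)
  also have "\<dots> \<in> sets borel"
    using B D by (intro saturation_borel[OF G D]) (auto simp: fundamental_domain_def)
  finally show "coset_rep G D -` B \<inter> space borel \<in> sets borel" by simp
qed simp

section \<open>Determinant estimates for complex matrices\<close>

lemma norm_vec_sq: "(norm (v :: complex ^ 'n))\<^sup>2 = (\<Sum>i\<in>UNIV. (cmod (v $ i))\<^sup>2)"
  by (simp add: norm_vec_def L2_set_def sum_nonneg)

lemma norm_matrix_vector_le:
  fixes A :: "complex ^ 'n ^ 'n"
  assumes "\<And>i j. cmod (A $ i $ j) \<le> 1"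
  shows "norm (A *v v) \<le> real CARD('n) ^ 2 * norm v"
proof -
  have "cmod ((A *v v) $ i) \<le> real CARD('n) * norm v" for i
  proof -
    have "cmod ((A *v v) $ i) \<le> (\<Sum>j\<in>UNIV. cmod (A $ i $ j * v $ j))"
      by (simp add: matrix_vector_mult_def norm_sum)
    also have "\<dots> \<le> (\<Sum>j\<in>(UNIV :: 'n set). 1 * norm v)"
      unfolding norm_mult by (intro sum_mono mult_mono assms Finite_Cartesian_Product.norm_nth_le) auto
    finally show ?thesis by simp
  qed
  then have "(\<Sum>i\<in>UNIV. cmod ((A *v v) $ i)) \<le> (\<Sum>i\<in>(UNIV :: 'n set). real CARD('n) * norm v)"
    by (rule sum_mono)
  moreover have "norm (A *v v) \<le> (\<Sum>i\<in>UNIV. cmod ((A *v v) $ i))"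
    unfolding norm_vec_def by (rule L2_set_le_sum) auto
  ultimately show ?thesis by (simp add: power2_eq_square)
qed

text \<open>
  Bounds that depend on the column serve both Cramer's rule, where a single column is large, and the
  inverse matrix, where all columns obey the same bound.
\<close>
lemma norm_det_le:
  fixes A :: "complex ^ 'n ^ 'n" and w :: "'n \<Rightarrow> real"
  assumes "\<And>i j. cmod (A $ i $ j) \<le> w j"
  shows "cmod (det A) \<le> fact CARD('n) * (\<Prod>j\<in>UNIV. w j)"
proof -
  have "cmod (det A) \<le> (\<Sum>p | p permutes (UNIV :: 'n set). \<Prod>j\<in>UNIV. w j)"
    unfolding det_def
  proof (rule sum_norm_le)
    fix p :: "'n \<Rightarrow> 'n" assume "p \<in> {p. p permutes UNIV}"
    then have p: "p permutes UNIV" by simp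
    have "cmod (of_int (sign p) * (\<Prod>i\<in>UNIV. A $ i $ p i)) = (\<Prod>i\<in>UNIV. cmod (A $ i $ p i))"
      by (simp add: norm_mult sign_def prod_norm)
    also have "\<dots> \<le> (\<Prod>i\<in>UNIV. w (p i))"
      by (intro prod_mono) (simp add: assms)
    also have "\<dots> = (\<Prod>j\<in>UNIV. w j)"
      using prod.permute[OF p, of w] by (simp add: o_def)
    finally show "cmod (of_int (sign p) * (\<Prod>i\<in>UNIV. A $ i $ p i)) \<le> (\<Prod>j\<in>UNIV. w j)" .
  qed
  also have "\<dots> = fact CARD('n) * (\<Prod>j\<in>UNIV. w j)"
    by (simp add: card_permutations[OF refl finite])
  finally show ?thesis .
qed

text \<open>
  By Cramer's rule \<open>det A * v $ k\<close> is the determinant of \<open>A\<close> with column \<open>k\<close> replaced by \<open>A *v v\<close>, and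
  all other columns have entries of modulus at most 1.
\<close>
lemma det_times_norm_le:
  fixes A :: "complex ^ 'n ^ 'n"
  assumes "\<And>i j. cmod (A $ i $ j) \<le> 1"
  shows "cmod (det A) * norm v \<le> real CARD('n) * fact CARD('n) * norm (A *v v)"
proof -
  have "cmod (det A * v $ k) \<le> fact CARD('n) * norm (A *v v)" for k
  proof -
    let ?B = "\<chi> i j. if j = k then (A *v v) $ i else A $ i $ j"
    have "det ?B = v $ k * det A"
      by (rule cramer_lemma)
    moreover have "cmod (det ?B) \<le> fact CARD('n) * (\<Prod>j\<in>UNIV. if j = k then norm (A *v v) else 1)"
      by (intro norm_det_le) (simp add: assms Finite_Cartesian_Product.norm_nth_le)
    ultimately show ?thesis by (simp add: prod.delta mult.commute)
  qed
  then have "(\<Sum>k\<in>UNIV. cmod (det A * v $ k)) \<le> (\<Sum>k\<in>(UNIV :: 'n set). fact CARD('n) * norm (A *v v))"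
    by (rule sum_mono)
  moreover have "cmod (det A) * norm v \<le> cmod (det A) * (\<Sum>k\<in>UNIV. cmod (v $ k))"
    unfolding norm_vec_def by (intro mult_left_mono L2_set_le_sum) auto
  ultimately show ?thesis by (simp add: norm_mult sum_distrib_left)
qed

text \<open>
  The hypothesis bounds the inverse matrix by \<open>1 / c\<close>, hence its determinant from above, and that
  determinant is the reciprocal of \<open>det A\<close>.
\<close>
lemma det_lower_bound:
  fixes A :: "complex ^ 'n ^ 'n"
  assumes c: "0 < c" and bound: "\<And>v. c * norm v \<le> norm (A *v v)"
  shows "c ^ CARD('n) / fact CARD('n) \<le> cmod (det A)"
proof -
  have "v = 0" if "A *v v = 0" for v
    using bound[of v] that c by (simp add: mult_le_0_iff)
  then have "\<exists>B. B ** A = mat 1"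
    by (simp add: matrix_left_invertible_ker)
  then obtain B where BA: "B ** A = mat 1" by blast
  then have AB: "A ** B = mat 1" by (simp add: matrix_left_right_inverse)
  have "cmod (B $ i $ j) \<le> 1 / c" for i j
  proof -
    have "A *v (B *v axis j 1) = axis j 1"
      by (simp add: matrix_vector_mul_assoc AB)
    then have "c * norm (B *v axis j 1) \<le> norm (axis j (1 :: complex))"
      using bound[of "B *v axis j 1"] by simp
    moreover have "norm (axis j (1 :: complex)) = 1"
      by (simp add: norm_vec_def L2_set_def axis_def if_distrib[of cmod] if_distrib[of "\<lambda>r. r\<^sup>2"] cong: if_cong)
    ultimately have "c * norm (B *v axis j 1) \<le> 1" by simp
    moreover have "B $ i $ j = (B *v axis j 1) $ i"
      by (simp add: matrix_vector_mult_def axis_def if_distrib[of "\<lambda>r. _ * r"] cong: if_cong)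
    then have "cmod (B $ i $ j) \<le> norm (B *v axis j 1)"
      by (simp add: Finite_Cartesian_Product.norm_nth_le)
    ultimately have "c * cmod (B $ i $ j) \<le> 1"
      using c by (smt (verit) mult_left_mono)
    then show ?thesis using c by (simp add: field_simps)
  qed
  then have "cmod (det B) \<le> fact CARD('n) * (\<Prod>j\<in>(UNIV :: 'n set). 1 / c)"
    by (rule norm_det_le)
  then have B: "cmod (det B) \<le> fact CARD('n) / c ^ CARD('n)"
    by (simp add: power_one_over)
  have "det A * det B = 1"
    using AB by (metis det_I det_mul)
  then have "1 = cmod (det A) * cmod (det B)"
    by (metis norm_mult norm_one)
  also have "\<dots> \<le> cmod (det A) * (fact CARD('n) / c ^ CARD('n))"
    by (intro mult_left_mono B) auto
  finally show ?thesis using c by (simp add: field_simps)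
qed

definition adjoint_matrix :: "complex ^ 'n ^ 'n \<Rightarrow> complex ^ 'n ^ 'n" where
  "adjoint_matrix A = (\<chi> i j. cnj (A $ j $ i))"

lemma norm_det_adjoint: "cmod (det (adjoint_matrix A)) = cmod (det A)"
proof -
  have "det (adjoint_matrix A) = det (\<chi> i j. cnj (A $ i $ j))"
    using det_transpose[of "\<chi> i j. cnj (A $ i $ j)"] by (simp add: adjoint_matrix_def transpose_def)
  also have "\<dots> = cnj (det A)"
    by (simp add: det_def)
  finally show ?thesis by simp
qed

lemma norm_det_scale_columns:
  fixes A :: "complex ^ 'n ^ 'n"
  assumes "\<And>k. cmod (u k) = 1"
  shows "cmod (det (\<chi> j k. u k * A $ j $ k)) = cmod (det A)"
proof -
  have "det (\<chi> j k. u k * A $ j $ k) = det (\<chi> k. u k *s (\<chi> j. A $ j $ k))"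
    using det_transpose[of "\<chi> j k. u k * A $ j $ k"]
    by (simp add: transpose_def vector_scalar_mult_def)
  also have "\<dots> = prod u UNIV * det (transpose A)"
    by (simp add: det_rows_mul transpose_def)
  finally show ?thesis by (simp add: norm_mult assms flip: prod_norm)
qed

text \<open>
  An almost-everywhere statement about a family of matrices can be combined over countably many vectors
  only; this extends it to all vectors.
\<close>
lemma norm_matrix_vector_ge_of_dense:
  fixes M :: "complex ^ 'n ^ 'n"
  assumes dense: "\<And>U. open U \<Longrightarrow> U \<noteq> {} \<Longrightarrow> \<exists>v\<in>Z. v \<in> U"
    and Z: "\<And>v. v \<in> Z \<Longrightarrow> a * (norm v)\<^sup>2 \<le> b * (norm (M *v v))\<^sup>2"
  shows "a * (norm v)\<^sup>2 \<le> b * (norm (M *v v))\<^sup>2"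
proof (rule ccontr)
  let ?U = "{v. b * (norm (M *v v))\<^sup>2 < a * (norm v)\<^sup>2}"
  assume "\<not> ?thesis"
  then have "?U \<noteq> {}" by (auto simp: not_le)
  moreover have "continuous_on UNIV (\<lambda>v. M *v v)"
    unfolding matrix_vector_mult_def by (intro continuous_intros)
  then have "open ?U"
    by (intro open_Collect_less continuous_intros)
  ultimately obtain w where "w \<in> Z" "w \<in> ?U" using dense by meson
  then show False using Z[of w] by simp
qed

section \<open>Characters and sums over unions of translates\<close>

lemma character_eq_cis: "character l x = cis (2 * pi * (l \<bullet> x))"
  by (simp add: character_def cis_conv_exp mult_ac)

lemma norm_character [simp]: "cmod (character l x) = 1"
  by (simp add: character_eq_cis)

lemma character_add_left: "character (l + m) x = character l x * character m x"
  by (simp add: character_eq_cis cis_mult inner_add_left distrib_left)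

lemma character_add_right: "character l (x + y) = character l x * character l y"
  by (simp add: character_eq_cis cis_mult inner_add_right distrib_left)

lemma character_minus_left: "character (- l) x = cnj (character l x)"
  by (simp add: character_eq_cis cis_cnj)

lemma character_eq_1: "l \<bullet> x \<in> \<int> \<Longrightarrow> character l x = 1"
  by (simp add: character_eq_cis cis_multiple_2pi)

lemma character_measurable [measurable]: "character l \<in> borel_measurable borel"
  unfolding character_eq_cis[abs_def] cis_conv_exp
  by (intro borel_measurable_continuous_onI continuous_intros)

text \<open>
  Characters with frequency in the dual group do not see shifts by \<open>G\<close>.  This is why frequencies of the
  base measure give the same exponential on every sheet.
\<close>
lemma character_dual_shift:
  assumes "l \<in> dual_group G" "y - x \<in> G"
  shows "character l y = character l x"
proof -
  have "character l (y - x) = 1" using assms by (intro character_eq_1) (simp add: dual_group_def)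
  then show ?thesis using character_add_right[of l "y - x" x] by simp
qed

lemma cnj_measurable [measurable]: "cnj \<in> borel_measurable borel"
  by (intro borel_measurable_continuous_onI continuous_intros)

lemma riesz_imp_frame: "riesz_spectrum \<rho> \<Lambda> \<Longrightarrow> frame_spectrum \<rho> \<Lambda>"
  by (simp add: riesz_spectrum_def)

lemma norm_trig_sum_le: "cmod (\<Sum>l\<in>F. c l * character l x) \<le> (\<Sum>l\<in>F. cmod (c l))"
  by (rule sum_norm_le) (simp add: norm_mult)

lemma trig_sum_square_integrable:
  assumes "finite_measure \<rho>" and sets: "sets \<rho> = sets borel"
  shows "square_integrable \<rho> (\<lambda>x. \<Sum>l\<in>F. c l * character l x)"
  unfolding square_integrable_def
proof
  show m: "(\<lambda>x. \<Sum>l\<in>F. c l * character l x) \<in> borel_measurable \<rho>"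
    unfolding measurable_cong_sets[OF sets refl] by measurable
  show "integrable \<rho> (\<lambda>x. (cmod (\<Sum>l\<in>F. c l * character l x))\<^sup>2)"
  proof (rule finite_measure.integrable_const_bound[OF assms(1)])
    show "AE x in \<rho>. norm ((cmod (\<Sum>l\<in>F. c l * character l x))\<^sup>2) \<le> (\<Sum>l\<in>F. cmod (c l))\<^sup>2"
      by (simp add: power_mono norm_trig_sum_le)
    show "(\<lambda>x. (cmod (\<Sum>l\<in>F. c l * character l x))\<^sup>2) \<in> borel_measurable \<rho>"
      using m by measurable
  qed
qed

lemma summable_on_translates_union:
  fixes h :: "real ^ 'd \<Rightarrow> real" and t :: "'n::finite \<Rightarrow> real ^ 'd"
  assumes nonneg: "\<And>l. 0 \<le> h l" and summ: "\<And>k. (\<lambda>l. h (l + t k)) summable_on \<Lambda>"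
  shows "h summable_on translates_union t \<Lambda>"
    and "infsum h (translates_union t \<Lambda>) \<le> (\<Sum>k\<in>UNIV. \<Sum>\<^sub>\<infinity>l\<in>\<Lambda>. h (l + t k))"
    and "(\<And>j k. j \<noteq> k \<Longrightarrow> (\<lambda>l. l + t j) ` \<Lambda> \<inter> (\<lambda>l. l + t k) ` \<Lambda> = {}) \<Longrightarrow>
      infsum h (translates_union t \<Lambda>) = (\<Sum>k\<in>UNIV. \<Sum>\<^sub>\<infinity>l\<in>\<Lambda>. h (l + t k))"
proof -
  let ?T = "\<lambda>k. (\<lambda>l. l + t k) ` \<Lambda>"
  have inj: "inj_on (\<lambda>l. l + t k) \<Lambda>" for k by (simp add: inj_on_def)
  have summT: "h summable_on ?T k" for k
    using summ[of k] by (simp add: summable_on_reindex[OF inj] o_def)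
  have infT: "infsum h (?T k) = (\<Sum>\<^sub>\<infinity>l\<in>\<Lambda>. h (l + t k))" for k
    by (simp add: infsum_reindex[OF inj] o_def)
  have "h summable_on (\<Union>k\<in>K. ?T k) \<and> infsum h (\<Union>k\<in>K. ?T k) \<le> (\<Sum>k\<in>K. infsum h (?T k))"
    if "finite K" for K
    using that
  proof (induction K)
    case (insert j K)
    let ?U = "\<Union>k\<in>K. ?T k"
    have U: "h summable_on ?U" and le: "infsum h ?U \<le> (\<Sum>k\<in>K. infsum h (?T k))"
      using insert.IH by auto
    have d: "h summable_on (?T j - ?U)"
      by (rule summable_on_subset[OF summT]) auto
    have "infsum h (?T j - ?U) \<le> infsum h (?T j)"
      by (rule infsum_mono_neutral[OF d summT]) (use nonneg in auto)
    moreover have "infsum h ((?T j - ?U) \<union> ?U) = infsum h (?T j - ?U) + infsum h ?U"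
      by (rule infsum_Un_disjoint[OF d U]) auto
    moreover have "h summable_on ((?T j - ?U) \<union> ?U)"
      by (rule summable_on_Un_disjoint[OF d U]) auto
    moreover have "(?T j - ?U) \<union> ?U = (\<Union>k\<in>insert j K. ?T k)" by blast
    ultimately show ?case using le insert.hyps by simp
  qed simp
  from this[of UNIV] show "h summable_on translates_union t \<Lambda>"
    and "infsum h (translates_union t \<Lambda>) \<le> (\<Sum>k\<in>UNIV. \<Sum>\<^sub>\<infinity>l\<in>\<Lambda>. h (l + t k))"
    by (simp_all add: translates_union_def infT)
  show "infsum h (translates_union t \<Lambda>) = (\<Sum>k\<in>UNIV. \<Sum>\<^sub>\<infinity>l\<in>\<Lambda>. h (l + t k))"
    if "\<And>j k. j \<noteq> k \<Longrightarrow> ?T j \<inter> ?T k = {}"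
    using sum_infsum[of UNIV h ?T] summT that by (simp add: translates_union_def infT)
qed

section \<open>The multi-tiling measure as a sum of image measures\<close>

locale multi_tiling =
  fixes G D S :: "(real ^ 'd) set"
    and \<nu> \<mu> :: "(real ^ 'd) measure"
    and \<mu>s :: "'n::finite \<Rightarrow> (real ^ 'd) measure"
    and X :: "'n \<Rightarrow> (real ^ 'd) set"
  assumes G: "closed_additive_subgroup G"
    and D: "fundamental_domain G D"
    and nu: "finite_borel_measure \<nu>"
    and S: "essential_support \<nu> S"
    and SD: "S \<subseteq> D"
    and tiling: "multi_tiling_measure G D \<nu> S \<mu>s X \<mu>"
begin

lemma sets_nu [measurable_cong]: "sets \<nu> = sets borel" and finite_nu: "finite_measure \<nu>"
  using nu by (simp_all add: finite_borel_measure_def)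

sublocale finite_measure \<nu> by (rule finite_nu)

lemma space_nu: "space \<nu> = UNIV"
  using sets_eq_imp_space_eq[OF sets_nu] by simp

lemma sets_mu [measurable_cong]: "sets \<mu> = sets borel"
  using tiling by (simp add: multi_tiling_measure_def)

lemma space_mu: "space \<mu> = UNIV"
  using sets_eq_imp_space_eq[OF sets_mu] by simp

lemma AE_S: "AE x in \<nu>. x \<in> S"
proof -
  have S': "S \<in> sets \<nu>" "emeasure \<nu> S = emeasure \<nu> (space \<nu>)"
    using S by (auto simp: essential_support_def sets_nu space_nu)
  then have "emeasure \<nu> (space \<nu> - S) = 0"
    by (simp add: emeasure_compl)
  then have "space \<nu> - S \<in> null_sets \<nu>" using S' by (auto simp: null_sets_def)
  then show ?thesis by (rule AE_I') auto
qed

definition sheet_domain :: "'n \<Rightarrow> (real ^ 'd) set" where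
  "sheet_domain k = (SOME E. fundamental_domain G E \<and> X k \<subseteq> E)"

lemma sheet_domain: "fundamental_domain G (sheet_domain k)" "X k \<subseteq> sheet_domain k"
proof -
  have "\<exists>E. fundamental_domain G E \<and> X k \<subseteq> E"
    using tiling by (simp add: multi_tiling_measure_def)
  from someI_ex[OF this] show "fundamental_domain G (sheet_domain k)" "X k \<subseteq> sheet_domain k"
    by (simp_all add: sheet_domain_def)
qed

text \<open>
  On \<open>S\<close> this inverts the projection \<open>\<pi>\<^sub>k\<close> of the sheet \<open>X k\<close>, so that there \<open>place k x = x + g\<^sub>k(x)\<close>.  Being
  defined on the whole space by \<open>coset_rep\<close>, it is Borel everywhere.
\<close>
definition place :: "'n \<Rightarrow> real ^ 'd \<Rightarrow> real ^ 'd" where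
  "place k = coset_rep G (sheet_domain k)"

lemma place_measurable [measurable]: "place k \<in> borel_measurable borel"
  unfolding place_def by (rule coset_rep_measurable[OF G sheet_domain(1)])

lemma minus_mem_G: "x \<in> G \<Longrightarrow> - x \<in> G"
  using G by (simp add: closed_additive_subgroup_def)

lemma diff_mem_G_swap: "x - y \<in> G \<Longrightarrow> y - x \<in> G"
  using minus_mem_G[of "x - y"] by simp

lemma place_shift: "place k x - x \<in> G"
  using coset_rep_mem(2)[OF G sheet_domain(1)[of k], of x] by (simp add: place_def diff_mem_G_swap)

lemma place_eqI: "y \<in> X k \<Longrightarrow> x - y \<in> G \<Longrightarrow> place k x = y"
  unfolding place_def using sheet_domain(2) by (intro coset_rep_eqI[OF G sheet_domain(1)]) auto

lemma coset_rep_place: "x \<in> D \<Longrightarrow> coset_rep G D (place k x) = x"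
  by (intro coset_rep_eqI[OF G D] place_shift)

lemma place_mem_X: "x \<in> S \<Longrightarrow> place k x \<in> X k"
proof -
  assume "x \<in> S"
  moreover have "S \<subseteq> coset_rep G D ` X k" using tiling by (simp add: multi_tiling_measure_def)
  ultimately obtain y where "y \<in> X k" "x = coset_rep G D y" by blast
  then show ?thesis using place_eqI[of y k x] coset_rep_mem[OF G D, of y]
    by (simp add: diff_mem_G_swap)
qed

lemma X_borel [measurable]: "X k \<in> sets borel"
  using tiling by (simp add: multi_tiling_measure_def essential_support_def)

text \<open>
  The image in the definition of \<open>\<mu>\<^sub>k\<close> is the Borel set \<open>D \<inter> place k -` (B \<inter> X k)\<close>, so its measure is not
  the default value 0 that \<open>emeasure\<close> takes outside the \<open>\<sigma>\<close>-algebra.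
\<close>
lemma emeasure_mus:
  assumes B [measurable]: "B \<in> sets borel"
  shows "emeasure (\<mu>s k) B = emeasure \<nu> (place k -` B)"
proof -
  have [measurable]: "D \<in> sets borel" using D by (simp add: fundamental_domain_def)
  have "coset_rep G D ` (B \<inter> X k) = D \<inter> place k -` (B \<inter> X k)"
  proof (intro set_eqI iffI)
    fix x assume "x \<in> coset_rep G D ` (B \<inter> X k)"
    then obtain y where y: "y \<in> B \<inter> X k" "x = coset_rep G D y" by blast
    then have "place k x = y"
      using coset_rep_mem[OF G D, of y] by (intro place_eqI) (auto simp: diff_mem_G_swap)
    then show "x \<in> D \<inter> place k -` (B \<inter> X k)"
      using y coset_rep_mem[OF G D, of y] by simp
  next
    fix x assume "x \<in> D \<inter> place k -` (B \<inter> X k)"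
    then show "x \<in> coset_rep G D ` (B \<inter> X k)"
      using coset_rep_place[of x k] by (intro image_eqI[of _ _ "place k x"]) auto
  qed
  then have "emeasure (\<mu>s k) B = emeasure \<nu> (D \<inter> place k -` (B \<inter> X k))"
    using tiling B by (simp add: multi_tiling_measure_def)
  also have "\<dots> = emeasure \<nu> (place k -` B)"
  proof (rule emeasure_eq_AE)
    show "AE x in \<nu>. x \<in> D \<inter> place k -` (B \<inter> X k) \<longleftrightarrow> x \<in> place k -` B"
      using AE_S by eventually_elim (use SD place_mem_X in auto)
    show "D \<inter> place k -` (B \<inter> X k) \<in> sets \<nu>" "place k -` B \<in> sets \<nu>"
      using measurable_sets_borel[OF place_measurable[of k]]
      by (auto simp: sets_nu)
  qed
  finally show ?thesis .
qed

lemma emeasure_mu: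
  assumes "B \<in> sets borel"
  shows "emeasure \<mu> B = (\<Sum>k\<in>UNIV. emeasure \<nu> (place k -` B))"
  using tiling assms emeasure_mus by (simp add: multi_tiling_measure_def)

text \<open>
  Disjointness of the sheets up to null sets lets the values of a function on the different sheets over
  \<open>x\<close> be prescribed independently.
\<close>
lemma place_disjoint:
  assumes "j \<noteq> k"
  shows "AE x in \<nu>. place j x \<notin> X k"
proof -
  have "emeasure \<mu> (X j \<inter> X k) = 0"
    using tiling assms unfolding multi_tiling_measure_def by blast
  then have "emeasure \<nu> (place j -` (X j \<inter> X k)) = 0"
    by (simp add: emeasure_mu)
  moreover have "place j -` (X j \<inter> X k) \<in> sets \<nu>"
    using measurable_sets_borel[OF place_measurable[of j], of "X j \<inter> X k"] by (simp add: sets_nu)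
  ultimately have "AE x in \<nu>. x \<notin> place j -` (X j \<inter> X k)"
    by (intro AE_not_in) (simp add: null_sets_def)
  with AE_S show ?thesis
    by eventually_elim (use place_mem_X in auto)
qed

lemma pair_sigma_finite_sheets: "pair_sigma_finite (count_space (UNIV :: 'n set)) \<nu>"
  by (intro pair_sigma_finite.intro sigma_finite_measure_count_space_finite finite sigma_finite_measure_axioms)

lemma place_pair_measurable [measurable]:
  "(\<lambda>(k, x). place k x) \<in> count_space UNIV \<Otimes>\<^sub>M \<nu> \<rightarrow>\<^sub>M borel"
  by (rule measurable_pair_measure_countable1) auto

text \<open>
  Writing \<open>\<mu>\<close> as a single image measure of \<open>N\<close> copies of \<open>\<nu>\<close> reduces integration against \<open>\<mu>\<close> to Fubini's
  theorem.
\<close>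
lemma mu_eq_distr: "\<mu> = distr (count_space UNIV \<Otimes>\<^sub>M \<nu>) borel (\<lambda>(k, x). place k x)"
proof (rule measure_eqI)
  fix B assume "B \<in> sets \<mu>"
  then have B [measurable]: "B \<in> sets borel" by (simp add: sets_mu)
  let ?E = "(\<lambda>(k, x). place k x) -` B \<inter> space (count_space UNIV \<Otimes>\<^sub>M \<nu>)"
  have "emeasure (count_space UNIV \<Otimes>\<^sub>M \<nu>) ?E
      = (\<integral>\<^sup>+k. emeasure \<nu> (Pair k -` ?E) \<partial>count_space UNIV)"
    by (rule emeasure_pair_measure_alt) measurable
  also have "\<dots> = (\<Sum>k\<in>UNIV. emeasure \<nu> (place k -` B))"
    by (simp add: nn_integral_count_space_finite space_pair_measure space_nu vimage_def)
  also have "\<dots> = emeasure \<mu> B"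
    by (rule emeasure_mu[OF B, symmetric])
  finally show "emeasure \<mu> B = emeasure (distr (count_space UNIV \<Otimes>\<^sub>M \<nu>) borel (\<lambda>(k, x). place k x)) B"
    by (simp add: emeasure_distr)
qed (simp add: sets_mu)

lemma nn_integral_mu:
  assumes [measurable]: "f \<in> borel_measurable borel"
  shows "(\<integral>\<^sup>+y. f y \<partial>\<mu>) = (\<Sum>k\<in>UNIV. \<integral>\<^sup>+x. f (place k x) \<partial>\<nu>)"
proof -
  have "(\<integral>\<^sup>+y. f y \<partial>\<mu>) = (\<integral>\<^sup>+p. f (case p of (k, x) \<Rightarrow> place k x) \<partial>(count_space UNIV \<Otimes>\<^sub>M \<nu>))"
    unfolding mu_eq_distr by (rule nn_integral_distr) auto
  also have "\<dots> = (\<integral>\<^sup>+k. \<integral>\<^sup>+x. f (place k x) \<partial>\<nu> \<partial>count_space UNIV)"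
    by (subst nn_integral_fst[symmetric]) auto
  finally show ?thesis by (simp add: nn_integral_count_space_finite)
qed

lemma integrable_mu_iff:
  fixes f :: "real ^ 'd \<Rightarrow> 'b::{banach, second_countable_topology}"
  assumes [measurable]: "f \<in> borel_measurable borel"
  shows "integrable \<mu> f \<longleftrightarrow> (\<forall>k. integrable \<nu> (\<lambda>x. f (place k x)))"
proof -
  have "f \<in> borel_measurable \<mu>" by (simp add: measurable_cong_sets[OF sets_mu refl])
  moreover have "(\<lambda>x. f (place k x)) \<in> borel_measurable \<nu>" for k by measurable
  ultimately show ?thesis
    by (simp add: integrable_iff_bounded nn_integral_mu)
qed

lemma integral_mu:
  fixes f :: "real ^ 'd \<Rightarrow> 'b::{banach, second_countable_topology}"
  assumes [measurable]: "f \<in> borel_measurable borel" and int: "integrable \<mu> f"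
  shows "(LINT y|\<mu>. f y) = (\<Sum>k\<in>UNIV. LINT x|\<nu>. f (place k x))"
proof -
  interpret P: pair_sigma_finite "count_space (UNIV :: 'n set)" \<nu>
    by (rule pair_sigma_finite_sheets)
  have int': "integrable (count_space UNIV \<Otimes>\<^sub>M \<nu>) (\<lambda>p. f (case p of (k, x) \<Rightarrow> place k x))"
    using int unfolding mu_eq_distr by (subst (asm) integrable_distr_eq) auto
  have "(LINT y|\<mu>. f y) = (LINT p|(count_space UNIV \<Otimes>\<^sub>M \<nu>). f (case p of (k, x) \<Rightarrow> place k x))"
    unfolding mu_eq_distr by (rule integral_distr) auto
  also have "\<dots> = (LINT k|count_space UNIV. LINT x|\<nu>. f (place k x))"
    using P.integral_fst'[OF int'] by simp
  finally show ?thesis by (simp add: lebesgue_integral_count_space_finite)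
qed

lemma finite_mu: "finite_measure \<mu>"
  by (rule finite_measureI) (simp add: space_mu emeasure_mu ennreal_mult_eq_top_iff)

lemma borel_of_square_integrable_mu:
  "square_integrable \<mu> f \<Longrightarrow> f \<in> borel_measurable borel"
  by (simp add: square_integrable_def measurable_cong_sets[OF sets_mu refl])

text \<open>
  The values of \<open>f\<close> on all the sheets over \<open>x\<close>.
\<close>
definition fibre :: "(real ^ 'd \<Rightarrow> complex) \<Rightarrow> real ^ 'd \<Rightarrow> complex ^ 'n" where
  "fibre f x = (\<chi> j. f (place j x))"

lemma fibre_square:
  assumes f: "square_integrable \<mu> f"
  shows "integrable \<nu> (\<lambda>x. (norm (fibre f x))\<^sup>2)"
    and "(LINT y|\<mu>. (cmod (f y))\<^sup>2) = (LINT x|\<nu>. (norm (fibre f x))\<^sup>2)"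
    and "integrable \<nu> (\<lambda>x. f (place j x))"
proof -
  note [measurable] = borel_of_square_integrable_mu[OF f]
  have int: "integrable \<mu> (\<lambda>y. (cmod (f y))\<^sup>2)"
    using f by (simp add: square_integrable_def)
  then have sheet: "integrable \<nu> (\<lambda>x. (cmod (f (place j x)))\<^sup>2)" for j
    by (subst (asm) integrable_mu_iff) auto
  then show "integrable \<nu> (\<lambda>x. (norm (fibre f x))\<^sup>2)"
    unfolding norm_vec_sq fibre_def by simp
  have "(LINT y|\<mu>. (cmod (f y))\<^sup>2) = (\<Sum>j\<in>UNIV. LINT x|\<nu>. (cmod (f (place j x)))\<^sup>2)"
    by (rule integral_mu[OF _ int]) measurable
  then show "(LINT y|\<mu>. (cmod (f y))\<^sup>2) = (LINT x|\<nu>. (norm (fibre f x))\<^sup>2)"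
    unfolding norm_vec_sq fibre_def by (simp add: sheet)
  have "integrable \<nu> (\<lambda>x. cmod (f (place j x)))"
    by (rule square_integrable_imp_integrable[OF _ sheet]) measurable
  then show "integrable \<nu> (\<lambda>x. f (place j x))"
    by (rule integrable_norm_cancel) measurable
qed

lemma tiling_shift_eq: "x \<in> S \<Longrightarrow> tiling_shift G (X j) x = place j x - x"
proof -
  assume x: "x \<in> S"
  show ?thesis unfolding tiling_shift_def
  proof (rule the_equality)
    show "place j x - x \<in> G \<and> x + (place j x - x) \<in> X j"
      using place_mem_X[OF x] place_shift by simp
    show "g = place j x - x" if "g \<in> G \<and> x + g \<in> X j" for g
      using place_eqI[of "x + g" j x] that by (simp add: minus_mem_G)
  qed
qed

section \<open>The phase matrix and frame bounds\<close>

text \<open>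
  On \<open>S\<close> its entries are \<open>e\<^bsup>2\<pi>i t\<^sub>k \<cdot> (x + g\<^sub>j(x))\<^esup>\<close>: column \<open>k\<close> is column \<open>k\<close> of the tiling matrix times the unimodular
  factor \<open>e\<^bsup>2\<pi>i t\<^sub>k \<cdot> x\<^esup>\<close>.  This variant is measurable in \<open>x\<close> on the whole space and absorbs the factors that the
  translations \<open>t\<^sub>k\<close> produce.
\<close>
definition phase :: "('n \<Rightarrow> real ^ 'd) \<Rightarrow> real ^ 'd \<Rightarrow> complex ^ 'n ^ 'n" where
  "phase t x = (\<chi> j k. character (t k) (place j x))"

lemma norm_det_phase:
  assumes "x \<in> S"
  shows "cmod (det (phase t x)) = cmod (tiling_det G X t x)"
proof -
  have "phase t x = (\<chi> j k. character (t k) x * tiling_matrix G X t x $ j $ k)"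
    by (simp add: phase_def tiling_matrix_def tiling_shift_eq assms vec_eq_iff
        flip: character_add_right)
  then show ?thesis
    by (simp add: norm_det_scale_columns tiling_det_def)
qed

text \<open>
  Component \<open>k\<close> is the function on the base whose Fourier coefficient at \<open>l\<close> is that of \<open>f\<close> at \<open>l + t k\<close>,
  for every \<open>l\<close> in the dual group.
\<close>
definition analysis :: "('n \<Rightarrow> real ^ 'd) \<Rightarrow> (real ^ 'd \<Rightarrow> complex) \<Rightarrow> real ^ 'd \<Rightarrow> complex ^ 'n" where
  "analysis t f x = adjoint_matrix (phase t x) *v fibre f x"

lemma analysis_nth:
  "analysis t f x $ k = (\<Sum>j\<in>UNIV. cnj (character (t k) (place j x)) * f (place j x))"
  by (simp add: analysis_def adjoint_matrix_def phase_def fibre_def matrix_vector_mult_def)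

lemma norm_analysis_le: "norm (analysis t f x) \<le> real CARD('n) ^ 2 * norm (fibre f x)"
  unfolding analysis_def by (rule norm_matrix_vector_le) (simp add: adjoint_matrix_def phase_def)

lemma analysis_square:
  assumes f: "square_integrable \<mu> f"
  shows "square_integrable \<nu> (\<lambda>x. analysis t f x $ k)"
    and "integrable \<nu> (\<lambda>x. (norm (analysis t f x))\<^sup>2)"
    and "(LINT x|\<nu>. (norm (analysis t f x))\<^sup>2) = (\<Sum>k\<in>UNIV. LINT x|\<nu>. (cmod (analysis t f x $ k))\<^sup>2)"
proof -
  note [measurable] = borel_of_square_integrable_mu[OF f]
  have m [measurable]: "(\<lambda>x. analysis t f x $ k) \<in> borel_measurable \<nu>" for k
    unfolding analysis_nth by measurable
  have "integrable \<nu> (\<lambda>x. (cmod (analysis t f x $ k))\<^sup>2)" for k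
  proof (rule Bochner_Integration.integrable_bound)
    show "integrable \<nu> (\<lambda>x. (real CARD('n) ^ 2)\<^sup>2 * (norm (fibre f x))\<^sup>2)"
      by (intro integrable_mult_right fibre_square(1) f)
    have "(cmod (analysis t f x $ k))\<^sup>2 \<le> (real CARD('n) ^ 2 * norm (fibre f x))\<^sup>2" for x
      by (intro power_mono order_trans[OF Finite_Cartesian_Product.norm_nth_le norm_analysis_le]) auto
    then show "AE x in \<nu>. norm ((cmod (analysis t f x $ k))\<^sup>2)
        \<le> norm ((real CARD('n) ^ 2)\<^sup>2 * (norm (fibre f x))\<^sup>2)"
      by (simp add: power_mult_distrib)
  qed measurable
  then show "square_integrable \<nu> (\<lambda>x. analysis t f x $ k)"
    and "integrable \<nu> (\<lambda>x. (norm (analysis t f x))\<^sup>2)"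
    and "(LINT x|\<nu>. (norm (analysis t f x))\<^sup>2) = (\<Sum>k\<in>UNIV. LINT x|\<nu>. (cmod (analysis t f x $ k))\<^sup>2)"
    unfolding norm_vec_sq square_integrable_def by simp_all
qed

lemma fourier_coeff_translate:
  assumes f: "square_integrable \<mu> f" and l: "l \<in> dual_group G"
  shows "fourier_coeff \<mu> f (l + t k) = fourier_coeff \<nu> (\<lambda>x. analysis t f x $ k) l"
proof -
  note [measurable] = borel_of_square_integrable_mu[OF f]
  let ?h = "\<lambda>y. f y * character (- (l + t k)) y"
  have sheet: "integrable \<nu> (\<lambda>x. ?h (place j x))" for j
    by (rule Bochner_Integration.integrable_bound[OF fibre_square(3)[OF f, of j]])
      (auto simp: norm_mult)
  then have "integrable \<mu> ?h" by (subst integrable_mu_iff) auto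
  then have coeff: "fourier_coeff \<mu> f (l + t k) = (\<Sum>j\<in>UNIV. LINT x|\<nu>. ?h (place j x))"
    unfolding fourier_coeff_def by (intro integral_mu) measurable
  have sheets: "(\<Sum>j\<in>UNIV. ?h (place j x)) = analysis t f x $ k * character (- l) x" for x
    unfolding analysis_nth sum_distrib_right
    by (intro sum.cong)
      (simp_all add: character_minus_left character_add_left character_dual_shift[OF l place_shift] mult_ac
        del: minus_add_distrib)
  note coeff
  also have "(\<Sum>j\<in>UNIV. LINT x|\<nu>. ?h (place j x)) = (LINT x|\<nu>. (\<Sum>j\<in>UNIV. ?h (place j x)))"
    by (rule Bochner_Integration.integral_sum[symmetric]) (rule sheet)
  also have "\<dots> = (LINT x|\<nu>. analysis t f x $ k * character (- l) x)"
    by (simp only: sheets)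
  finally show ?thesis by (simp add: fourier_coeff_def)
qed

text \<open>
  The sum over each translate of \<open>\<Lambda>\<close> is a frame sum of one component of \<open>analysis t f\<close> with respect to
  \<open>\<nu>\<close>.  Overlapping translates only decrease the sum over their union, so disjointness matters for the
  lower bound only.
\<close>
lemma frame_sum_bounds:
  assumes \<Lambda>: "\<Lambda> \<subseteq> dual_group G" and f: "square_integrable \<mu> f"
    and frame: "\<And>g. square_integrable \<nu> g \<Longrightarrow>
      (\<lambda>l. (cmod (fourier_coeff \<nu> g l))\<^sup>2) summable_on \<Lambda> \<and>
      A * (LINT x|\<nu>. (cmod (g x))\<^sup>2) \<le> (\<Sum>\<^sub>\<infinity>l\<in>\<Lambda>. (cmod (fourier_coeff \<nu> g l))\<^sup>2) \<and>
      (\<Sum>\<^sub>\<infinity>l\<in>\<Lambda>. (cmod (fourier_coeff \<nu> g l))\<^sup>2) \<le> B * (LINT x|\<nu>. (cmod (g x))\<^sup>2)"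
  shows "(\<lambda>l. (cmod (fourier_coeff \<mu> f l))\<^sup>2) summable_on translates_union t \<Lambda>"
    and "(\<Sum>\<^sub>\<infinity>l\<in>translates_union t \<Lambda>. (cmod (fourier_coeff \<mu> f l))\<^sup>2)
      \<le> B * (LINT x|\<nu>. (norm (analysis t f x))\<^sup>2)"
    and "(\<And>j k. j \<noteq> k \<Longrightarrow> (\<lambda>l. l + t j) ` \<Lambda> \<inter> (\<lambda>l. l + t k) ` \<Lambda> = {}) \<Longrightarrow>
      A * (LINT x|\<nu>. (norm (analysis t f x))\<^sup>2)
      \<le> (\<Sum>\<^sub>\<infinity>l\<in>translates_union t \<Lambda>. (cmod (fourier_coeff \<mu> f l))\<^sup>2)"
proof -
  let ?h = "\<lambda>l. (cmod (fourier_coeff \<mu> f l))\<^sup>2"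
  let ?g = "\<lambda>k x. analysis t f x $ k"
  have h: "?h (l + t k) = (cmod (fourier_coeff \<nu> (?g k) l))\<^sup>2" if "l \<in> \<Lambda>" for l k
    using that \<Lambda> by (simp add: fourier_coeff_translate[OF f] subset_iff)
  have summ: "(\<lambda>l. ?h (l + t k)) summable_on \<Lambda>" for k
    using frame[OF analysis_square(1)[OF f, of t k]] by (simp add: h cong: summable_on_cong)
  have inf: "(\<Sum>\<^sub>\<infinity>l\<in>\<Lambda>. ?h (l + t k)) = (\<Sum>\<^sub>\<infinity>l\<in>\<Lambda>. (cmod (fourier_coeff \<nu> (?g k) l))\<^sup>2)" for k
    by (rule infsum_cong) (rule h)
  note union = summable_on_translates_union[of ?h t \<Lambda>, OF _ summ]
  show "?h summable_on translates_union t \<Lambda>"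
    by (rule union(1)) simp
  have "infsum ?h (translates_union t \<Lambda>) \<le> (\<Sum>k\<in>UNIV. \<Sum>\<^sub>\<infinity>l\<in>\<Lambda>. ?h (l + t k))"
    by (rule union(2)) simp
  also have "\<dots> \<le> (\<Sum>k\<in>UNIV. B * (LINT x|\<nu>. (cmod (?g k x))\<^sup>2))"
    unfolding inf using frame[OF analysis_square(1)[OF f]] by (intro sum_mono) blast
  finally show "infsum ?h (translates_union t \<Lambda>) \<le> B * (LINT x|\<nu>. (norm (analysis t f x))\<^sup>2)"
    by (simp add: analysis_square(3)[OF f] sum_distrib_left)
  assume "\<And>j k. j \<noteq> k \<Longrightarrow> (\<lambda>l. l + t j) ` \<Lambda> \<inter> (\<lambda>l. l + t k) ` \<Lambda> = {}"
  then have eq: "infsum ?h (translates_union t \<Lambda>) = (\<Sum>k\<in>UNIV. \<Sum>\<^sub>\<infinity>l\<in>\<Lambda>. ?h (l + t k))"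
    by (intro union(3)) auto
  have "A * (LINT x|\<nu>. (norm (analysis t f x))\<^sup>2) = (\<Sum>k\<in>UNIV. A * (LINT x|\<nu>. (cmod (?g k x))\<^sup>2))"
    by (simp add: analysis_square(3)[OF f] sum_distrib_left)
  also have "\<dots> \<le> (\<Sum>k\<in>UNIV. \<Sum>\<^sub>\<infinity>l\<in>\<Lambda>. ?h (l + t k))"
    unfolding inf using frame[OF analysis_square(1)[OF f]] by (intro sum_mono) blast
  finally show "A * (LINT x|\<nu>. (norm (analysis t f x))\<^sup>2) \<le> infsum ?h (translates_union t \<Lambda>)"
    by (simp add: eq)
qed

text \<open>
  If \<open>l + t j = l' + t k\<close> with \<open>l\<close> and \<open>l'\<close> in the dual group, then the characters of \<open>t j\<close> and \<open>t k\<close> agree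
  on \<open>G\<close>, so the tiling matrix has two equal columns over every point of \<open>S\<close>.
\<close>
lemma translates_disjoint:
  assumes \<Lambda>: "\<Lambda> \<subseteq> dual_group G" and "0 < \<epsilon>"
    and det: "AE x in \<nu>. \<epsilon> \<le> cmod (tiling_det G X t x)"
    and nonzero: "emeasure \<nu> UNIV \<noteq> 0" and "j \<noteq> k"
  shows "(\<lambda>l. l + t j) ` \<Lambda> \<inter> (\<lambda>l. l + t k) ` \<Lambda> = {}"
proof (rule ccontr)
  assume "\<not> ?thesis"
  then obtain l l' where ll': "l \<in> \<Lambda>" "l' \<in> \<Lambda>" "l + t j = l' + t k" by blast
  then have tj: "t j = (l' - l) + t k" by (simp add: algebra_simps)
  have "l' - l \<in> dual_group G"
    using ll' \<Lambda> unfolding dual_group_def by (auto simp: inner_diff_left intro!: Ints_diff)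
  then have same: "character (t j) g = character (t k) g" if "g \<in> G" for g
    using that unfolding tj character_add_left by (simp add: character_eq_1 dual_group_def)
  have zero: "tiling_det G X t x = 0" if "x \<in> S" for x
    unfolding tiling_det_def
    by (rule det_identical_columns[OF \<open>j \<noteq> k\<close>])
      (simp add: column_def tiling_matrix_def tiling_shift_eq[OF that] same[OF place_shift])
  have "AE x in \<nu>. False"
    using AE_S det by eventually_elim (use zero \<open>0 < \<epsilon>\<close> in auto)
  then show False
    using nonzero by (simp add: AE_iff_measurable[OF _ refl] space_nu)
qed

text \<open>
  The zero measure needs separate treatment: there the determinant bound is void and the translates of
  \<open>\<Lambda>\<close> may overlap.
\<close>
lemma frame_spectrum_null:
  assumes null: "emeasure \<nu> UNIV = 0" and "countable \<Lambda>"
  shows "frame_spectrum \<mu> \<Lambda>"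
proof -
  have "emeasure \<mu> (space \<mu>) = 0"
    by (simp add: space_mu emeasure_mu null)
  then have "AE y in \<mu>. P y" for P
    by (intro AE_I'[of "space \<mu>"]) (auto simp: null_sets_def)
  then have zero: "(LINT y|\<mu>. h y) = 0" for h :: "real ^ 'd \<Rightarrow> 'b::{banach, second_countable_topology}"
    by (rule integral_eq_zero_AE)
  show ?thesis
    unfolding frame_spectrum_def fourier_coeff_def zero
    by (intro conjI exI[of _ 1]) (simp_all add: \<open>countable \<Lambda>\<close>)
qed

lemma countable_translates_union: "countable \<Lambda> \<Longrightarrow> countable (translates_union t \<Lambda>)"
  unfolding translates_union_def by (intro countable_UN countable_image) auto

text \<open>
  The determinant bound makes the adjoint phase matrix bounded below, uniformly in \<open>x\<close>; unimodular
  entries bound it above.  So \<open>analysis t f\<close> and \<open>fibre f\<close> have comparable norms.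
\<close>
lemma frame_spectrum_translates:
  assumes \<Lambda>: "\<Lambda> \<subseteq> dual_group G" and \<epsilon>: "0 < \<epsilon>"
    and det: "AE x in \<nu>. \<epsilon> \<le> cmod (tiling_det G X t x)"
    and frame: "frame_spectrum \<nu> \<Lambda>"
  shows "frame_spectrum \<mu> (translates_union t \<Lambda>)"
proof (cases "emeasure \<nu> UNIV = 0")
  case True
  then show ?thesis
    using frame by (intro frame_spectrum_null countable_translates_union) (auto simp: frame_spectrum_def)
next
  case False
  obtain A B where AB: "0 < A" "A \<le> B" and bounds: "\<And>g. square_integrable \<nu> g \<Longrightarrow>
      (\<lambda>l. (cmod (fourier_coeff \<nu> g l))\<^sup>2) summable_on \<Lambda> \<and>
      A * (LINT x|\<nu>. (cmod (g x))\<^sup>2) \<le> (\<Sum>\<^sub>\<infinity>l\<in>\<Lambda>. (cmod (fourier_coeff \<nu> g l))\<^sup>2) \<and>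
      (\<Sum>\<^sub>\<infinity>l\<in>\<Lambda>. (cmod (fourier_coeff \<nu> g l))\<^sup>2) \<le> B * (LINT x|\<nu>. (cmod (g x))\<^sup>2)"
    using frame unfolding frame_spectrum_def by blast
  define c where "c = \<epsilon> / (real CARD('n) * fact CARD('n))"
  have c: "0 < c" using \<epsilon> by (simp add: c_def)
  define b where "b = (real CARD('n) ^ 2)\<^sup>2"
  have lower: "AE x in \<nu>. c * norm (fibre f x) \<le> norm (analysis t f x)" for f
    using AE_S det
  proof eventually_elim
    case (elim x)
    have "\<epsilon> * norm (fibre f x) \<le> cmod (det (adjoint_matrix (phase t x))) * norm (fibre f x)"
      using elim by (intro mult_right_mono) (simp_all add: norm_det_adjoint norm_det_phase)
    also have "\<dots> \<le> real CARD('n) * fact CARD('n) * norm (analysis t f x)"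
      unfolding analysis_def by (rule det_times_norm_le) (simp add: adjoint_matrix_def phase_def)
    finally show ?case by (simp add: c_def field_simps)
  qed
  show ?thesis unfolding frame_spectrum_def
  proof (intro conjI exI allI impI)
    show "countable (translates_union t \<Lambda>)"
      using frame by (intro countable_translates_union) (simp add: frame_spectrum_def)
    show "0 < A * c\<^sup>2" using AB c by simp
    \<comment> \<open>The maximum makes the upper constant dominate the lower one without comparing \<open>c\<close> and \<open>b\<close>.\<close>
    show "A * c\<^sup>2 \<le> max (A * c\<^sup>2) (B * b)" by simp
    fix f assume f: "square_integrable \<mu> f"
    let ?h = "\<lambda>l. (cmod (fourier_coeff \<mu> f l))\<^sup>2"
    note fb = frame_sum_bounds[OF \<Lambda> f bounds, of t]
    show "?h summable_on translates_union t \<Lambda>" by (rule fb(1))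
    have "c\<^sup>2 * (LINT x|\<nu>. (norm (fibre f x))\<^sup>2) = (LINT x|\<nu>. (c * norm (fibre f x))\<^sup>2)"
      by (simp add: power_mult_distrib)
    also have "\<dots> \<le> (LINT x|\<nu>. (norm (analysis t f x))\<^sup>2)"
    proof (rule integral_mono_AE)
      show "integrable \<nu> (\<lambda>x. (c * norm (fibre f x))\<^sup>2)"
        using fibre_square(1)[OF f] by (simp add: power_mult_distrib)
      show "integrable \<nu> (\<lambda>x. (norm (analysis t f x))\<^sup>2)"
        by (rule analysis_square(2)[OF f])
      show "AE x in \<nu>. (c * norm (fibre f x))\<^sup>2 \<le> (norm (analysis t f x))\<^sup>2"
        using lower[of f] by eventually_elim (use c in \<open>auto intro: power_mono\<close>)
    qed
    finally have "A * c\<^sup>2 * (LINT y|\<mu>. (cmod (f y))\<^sup>2) \<le> A * (LINT x|\<nu>. (norm (analysis t f x))\<^sup>2)"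
      using AB by (simp add: fibre_square(2)[OF f] mult.assoc)
    also have "\<dots> \<le> infsum ?h (translates_union t \<Lambda>)"
      by (rule fb(3)[OF _ translates_disjoint[OF \<Lambda> \<epsilon> det False]])
    finally show "A * c\<^sup>2 * (LINT y|\<mu>. (cmod (f y))\<^sup>2) \<le> infsum ?h (translates_union t \<Lambda>)" .
    have "infsum ?h (translates_union t \<Lambda>) \<le> B * (LINT x|\<nu>. (norm (analysis t f x))\<^sup>2)"
      by (rule fb(2))
    also have "(LINT x|\<nu>. (norm (analysis t f x))\<^sup>2) \<le> (LINT x|\<nu>. b * (norm (fibre f x))\<^sup>2)"
    proof (rule integral_mono)
      show "integrable \<nu> (\<lambda>x. (norm (analysis t f x))\<^sup>2)"
        by (rule analysis_square(2)[OF f])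
      show "integrable \<nu> (\<lambda>x. b * (norm (fibre f x))\<^sup>2)"
        using fibre_square(1)[OF f] by simp
      show "(norm (analysis t f x))\<^sup>2 \<le> b * (norm (fibre f x))\<^sup>2" for x
        using power_mono[OF norm_analysis_le[of t f x], of 2] by (simp add: b_def power_mult_distrib)
    qed
    also have "B * (LINT x|\<nu>. b * (norm (fibre f x))\<^sup>2) = B * b * (LINT y|\<mu>. (cmod (f y))\<^sup>2)"
      by (simp add: fibre_square(2)[OF f])
    also have "\<dots> \<le> max (A * c\<^sup>2) (B * b) * (LINT y|\<mu>. (cmod (f y))\<^sup>2)"
      by (intro mult_right_mono) auto
    finally show "infsum ?h (translates_union t \<Lambda>) \<le> max (A * c\<^sup>2) (B * b) * (LINT y|\<mu>. (cmod (f y))\<^sup>2)"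
      using AB by simp
  qed
qed

section \<open>Riesz bounds\<close>

text \<open>
  A trigonometric polynomial with frequencies in the union of translates restricts to the fibres as the
  phase matrix applied to a vector of trigonometric polynomials with frequencies in \<open>\<Lambda>\<close>.
\<close>
lemma fibre_trig_sum:
  assumes \<Lambda>: "\<Lambda> \<subseteq> dual_group G" and F: "finite F" "F \<subseteq> translates_union t \<Lambda>"
    and disj: "\<And>j k. j \<noteq> k \<Longrightarrow> (\<lambda>l. l + t j) ` \<Lambda> \<inter> (\<lambda>l. l + t k) ` \<Lambda> = {}"
  defines "E \<equiv> \<lambda>k. {l \<in> \<Lambda>. l + t k \<in> F}"
  shows "finite (E k)"
    and "(\<Sum>l\<in>F. h l) = (\<Sum>k\<in>UNIV. \<Sum>l\<in>E k. (h :: real ^ 'd \<Rightarrow> real) (l + t k))"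
    and "fibre (\<lambda>y. \<Sum>l\<in>F. c l * character l y) x
      = phase t x *v (\<chi> k. \<Sum>l\<in>E k. c (l + t k) * character l x)"
proof -
  show fin: "finite (E k)" for k
  proof -
    have "E k \<subseteq> (\<lambda>l. l - t k) ` F"
      by (force simp: E_def image_iff)
    then show ?thesis using F(1) finite_subset by blast
  qed
  have FE: "F = (\<Union>k. (\<lambda>l. l + t k) ` E k)"
    using F(2) unfolding E_def translates_union_def by fastforce
  have split: "(\<Sum>l\<in>F. h l) = (\<Sum>k\<in>UNIV. \<Sum>l\<in>E k. h (l + t k))"
    for h :: "real ^ 'd \<Rightarrow> 'b::comm_monoid_add"
  proof -
    have "(\<Sum>l\<in>F. h l) = (\<Sum>k\<in>UNIV. sum h ((\<lambda>l. l + t k) ` E k))"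
      unfolding FE
    proof (rule sum.UNION_disjoint)
      show "\<forall>j\<in>UNIV. \<forall>k\<in>UNIV. j \<noteq> k \<longrightarrow> (\<lambda>l. l + t j) ` E j \<inter> (\<lambda>l. l + t k) ` E k = {}"
        using disj unfolding E_def by blast
    qed (auto simp: fin)
    also have "\<dots> = (\<Sum>k\<in>UNIV. \<Sum>l\<in>E k. h (l + t k))"
      by (simp add: sum.reindex inj_on_def o_def)
    finally show ?thesis .
  qed
  show "fibre (\<lambda>y. \<Sum>l\<in>F. c l * character l y) x
      = phase t x *v (\<chi> k. \<Sum>l\<in>E k. c (l + t k) * character l x)"
  proof -
    have "(\<Sum>l\<in>F. c l * character l (place j x))
        = (\<Sum>k\<in>UNIV. character (t k) (place j x) * (\<Sum>l\<in>E k. c (l + t k) * character l x))" for j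
      unfolding split sum_distrib_left
    proof (intro sum.cong refl)
      fix k l assume "l \<in> E k"
      then have "l \<in> dual_group G" using \<Lambda> by (auto simp: E_def)
      then show "c (l + t k) * character (l + t k) (place j x)
          = character (t k) (place j x) * (c (l + t k) * character l x)"
        by (simp add: character_add_left character_dual_shift[OF _ place_shift] mult_ac)
    qed
    then show ?thesis
      by (simp add: fibre_def phase_def matrix_vector_mult_def vec_eq_iff)
  qed
  show "(\<Sum>l\<in>F. h l) = (\<Sum>k\<in>UNIV. \<Sum>l\<in>E k. h (l + t k))"
    by (rule split)
qed

text \<open>
  The dual of the frame estimate: the phase matrix itself, in place of its adjoint, turns the coefficient
  polynomials into the fibre values, with norms comparable by the determinant bound.
\<close>
lemma riesz_spectrum_translates:
  assumes \<Lambda>: "\<Lambda> \<subseteq> dual_group G" and \<epsilon>: "0 < \<epsilon>"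
    and det: "AE x in \<nu>. \<epsilon> \<le> cmod (tiling_det G X t x)"
    and riesz: "riesz_spectrum \<nu> \<Lambda>"
  shows "riesz_spectrum \<mu> (translates_union t \<Lambda>)"
proof -
  obtain A B where AB: "0 < A" "A \<le> B" and all: "\<forall>F c. finite F \<and> F \<subseteq> \<Lambda> \<longrightarrow>
      A * (\<Sum>l\<in>F. (cmod (c l))\<^sup>2) \<le> (LINT x|\<nu>. (cmod (\<Sum>l\<in>F. c l * character l x))\<^sup>2) \<and>
      (LINT x|\<nu>. (cmod (\<Sum>l\<in>F. c l * character l x))\<^sup>2) \<le> B * (\<Sum>l\<in>F. (cmod (c l))\<^sup>2)"
    using riesz unfolding riesz_spectrum_def by (elim conjE exE) (rule that)
  have bounds: "A * (\<Sum>l\<in>F. (cmod (c l))\<^sup>2) \<le> (LINT x|\<nu>. (cmod (\<Sum>l\<in>F. c l * character l x))\<^sup>2) \<and>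
      (LINT x|\<nu>. (cmod (\<Sum>l\<in>F. c l * character l x))\<^sup>2) \<le> B * (\<Sum>l\<in>F. (cmod (c l))\<^sup>2)" if "finite F" "F \<subseteq> \<Lambda>" for F c
    using all that by simp
  have disj: "(\<lambda>l. l + t j) ` \<Lambda> \<inter> (\<lambda>l. l + t k) ` \<Lambda> = {}" if "j \<noteq> k" for j k
  proof (cases "emeasure \<nu> UNIV = 0")
    case True
    \<comment> \<open>Over the zero measure a Riesz spectrum has no frequencies, since its exponentials have norm 0.\<close>
    have "\<Lambda> = {}"
    proof (rule ccontr)
      assume "\<Lambda> \<noteq> {}"
      then obtain l where "l \<in> \<Lambda>" by blast
      then have "A \<le> (LINT x|\<nu>. (cmod (character l x))\<^sup>2)"
        using bounds[of "{l}" "\<lambda>_. 1"] by simp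
      also have "\<dots> = 0" using True by (simp add: space_nu measure_def)
      finally show False using AB by simp
    qed
    then show ?thesis by simp
  next
    case False
    then show ?thesis by (rule translates_disjoint[OF \<Lambda> \<epsilon> det _ that])
  qed
  define c where "c = \<epsilon> / (real CARD('n) * fact CARD('n))"
  have c: "0 < c" using \<epsilon> by (simp add: c_def)
  define b where "b = (real CARD('n) ^ 2)\<^sup>2"
  have lower: "AE x in \<nu>. \<forall>v :: complex ^ 'n. c * norm v \<le> norm (phase t x *v v)"
    using AE_S det
  proof eventually_elim
    case (elim x)
    show ?case
    proof
      fix v :: "complex ^ 'n"
      have "\<epsilon> * norm v \<le> cmod (det (phase t x)) * norm v"
        using elim by (intro mult_right_mono) (simp_all add: norm_det_phase)
      also have "\<dots> \<le> real CARD('n) * fact CARD('n) * norm (phase t x *v v)"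
        by (rule det_times_norm_le) (simp add: phase_def)
      finally show "c * norm v \<le> norm (phase t x *v v)" by (simp add: c_def field_simps)
    qed
  qed
  have upper: "norm (phase t x *v v) \<le> real CARD('n) ^ 2 * norm v" for x and v :: "complex ^ 'n"
    by (rule norm_matrix_vector_le) (simp add: phase_def)
  have main: "A * c\<^sup>2 * (\<Sum>l\<in>F. (cmod (a l))\<^sup>2) \<le> (LINT y|\<mu>. (cmod (\<Sum>l\<in>F. a l * character l y))\<^sup>2) \<and>
      (LINT y|\<mu>. (cmod (\<Sum>l\<in>F. a l * character l y))\<^sup>2) \<le> B * b * (\<Sum>l\<in>F. (cmod (a l))\<^sup>2)"
    if F: "finite F" "F \<subseteq> translates_union t \<Lambda>" for F a
  proof -
    define E where "E k = {l \<in> \<Lambda>. l + t k \<in> F}" for k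
    have "E k \<subseteq> \<Lambda>" for k by (auto simp: E_def)
    note E = fibre_trig_sum(1)[OF \<Lambda> F disj, folded E_def] this
    note split = fibre_trig_sum(2)[OF \<Lambda> F disj, folded E_def]
    note fib = fibre_trig_sum(3)[OF \<Lambda> F disj, folded E_def]
    define P where "P x = (\<chi> k. \<Sum>l\<in>E k. a (l + t k) * character l x)" for x
    have P: "square_integrable \<nu> (\<lambda>x. P x $ k)" for k
      unfolding P_def using trig_sum_square_integrable[OF finite_nu sets_nu] by simp
    then have intP: "integrable \<nu> (\<lambda>x. (norm (P x))\<^sup>2)"
      and sumP: "(LINT x|\<nu>. (norm (P x))\<^sup>2) = (\<Sum>k\<in>UNIV. LINT x|\<nu>. (cmod (P x $ k))\<^sup>2)"
      unfolding norm_vec_sq square_integrable_def by simp_all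
    have sq: "square_integrable \<mu> (\<lambda>y. \<Sum>l\<in>F. a l * character l y)"
      by (rule trig_sum_square_integrable[OF finite_mu sets_mu])
    have int: "integrable \<nu> (\<lambda>x. (norm (phase t x *v P x))\<^sup>2)"
      and eq: "(LINT y|\<mu>. (cmod (\<Sum>l\<in>F. a l * character l y))\<^sup>2) = (LINT x|\<nu>. (norm (phase t x *v P x))\<^sup>2)"
      using fibre_square(1,2)[OF sq] by (simp_all add: fib P_def)
    have Pk: "A * (\<Sum>l\<in>E k. (cmod (a (l + t k)))\<^sup>2) \<le> (LINT x|\<nu>. (cmod (P x $ k))\<^sup>2) \<and>
        (LINT x|\<nu>. (cmod (P x $ k))\<^sup>2) \<le> B * (\<Sum>l\<in>E k. (cmod (a (l + t k)))\<^sup>2)" for k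
      using bounds[OF E(1)[of k] E(2)[of k], where c = "\<lambda>l. a (l + t k)"] by (simp add: P_def)
    have sumF: "(\<Sum>l\<in>F. (cmod (a l))\<^sup>2) = (\<Sum>k\<in>UNIV. \<Sum>l\<in>E k. (cmod (a (l + t k)))\<^sup>2)"
      by (rule split)
    have lowP: "A * (\<Sum>l\<in>F. (cmod (a l))\<^sup>2) \<le> (LINT x|\<nu>. (norm (P x))\<^sup>2)"
      unfolding sumF sumP by (subst sum_distrib_left, intro sum_mono) (use Pk in blast)
    have upP: "(LINT x|\<nu>. (norm (P x))\<^sup>2) \<le> B * (\<Sum>l\<in>F. (cmod (a l))\<^sup>2)"
      unfolding sumF sumP by (subst sum_distrib_left, intro sum_mono) (use Pk in blast)
    have "c\<^sup>2 * (LINT x|\<nu>. (norm (P x))\<^sup>2) = (LINT x|\<nu>. (c * norm (P x))\<^sup>2)"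
      by (simp add: power_mult_distrib)
    also have "\<dots> \<le> (LINT x|\<nu>. (norm (phase t x *v P x))\<^sup>2)"
    proof (rule integral_mono_AE)
      show "integrable \<nu> (\<lambda>x. (c * norm (P x))\<^sup>2)"
        using intP by (simp add: power_mult_distrib)
      show "AE x in \<nu>. (c * norm (P x))\<^sup>2 \<le> (norm (phase t x *v P x))\<^sup>2"
        using lower by eventually_elim (use c in \<open>auto intro: power_mono\<close>)
    qed (rule int)
    finally have 1: "c\<^sup>2 * (LINT x|\<nu>. (norm (P x))\<^sup>2) \<le> (LINT x|\<nu>. (norm (phase t x *v P x))\<^sup>2)" .
    have "(LINT x|\<nu>. (norm (phase t x *v P x))\<^sup>2) \<le> (LINT x|\<nu>. b * (norm (P x))\<^sup>2)"
    proof (rule integral_mono)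
      show "integrable \<nu> (\<lambda>x. b * (norm (P x))\<^sup>2)" using intP by simp
      show "(norm (phase t x *v P x))\<^sup>2 \<le> b * (norm (P x))\<^sup>2" for x
        using power_mono[OF upper[of x "P x"], of 2] by (simp add: b_def power_mult_distrib)
    qed (rule int)
    then have 2: "(LINT x|\<nu>. (norm (phase t x *v P x))\<^sup>2) \<le> b * (LINT x|\<nu>. (norm (P x))\<^sup>2)"
      by simp
    show ?thesis unfolding eq
      using order_trans[OF mult_left_mono[OF lowP, of "c\<^sup>2"] 1]
        order_trans[OF 2 mult_left_mono[OF upP, of b]]
      by (simp add: b_def mult_ac)
  qed
  show ?thesis unfolding riesz_spectrum_def
  proof (intro conjI exI allI impI)
    show "frame_spectrum \<mu> (translates_union t \<Lambda>)"
      using riesz by (intro frame_spectrum_translates[OF \<Lambda> \<epsilon> det]) (simp add: riesz_spectrum_def)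
    show "0 < A * c\<^sup>2" using AB c by simp
    show "A * c\<^sup>2 \<le> max (A * c\<^sup>2) (B * b)" by simp
    fix F a assume F: "finite F \<and> F \<subseteq> translates_union t \<Lambda>"
    then show "A * c\<^sup>2 * (\<Sum>l\<in>F. (cmod (a l))\<^sup>2) \<le> (LINT y|\<mu>. (cmod (\<Sum>l\<in>F. a l * character l y))\<^sup>2)"
      using main by blast
    have "(LINT y|\<mu>. (cmod (\<Sum>l\<in>F. a l * character l y))\<^sup>2) \<le> B * b * (\<Sum>l\<in>F. (cmod (a l))\<^sup>2)"
      using main F by blast
    also have "\<dots> \<le> max (A * c\<^sup>2) (B * b) * (\<Sum>l\<in>F. (cmod (a l))\<^sup>2)"
      by (intro mult_right_mono sum_nonneg) auto
    finally show "(LINT y|\<mu>. (cmod (\<Sum>l\<in>F. a l * character l y))\<^sup>2)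
        \<le> max (A * c\<^sup>2) (B * b) * (\<Sum>l\<in>F. (cmod (a l))\<^sup>2)" .
  qed
qed

section \<open>Recovering the determinant bound\<close>

text \<open>
  Testing the frame inequality on functions whose fibre is a constant vector \<open>v\<close> over an arbitrary
  Borel set of base points gives the pointwise bound \<open>a |v|\<^sup>2 \<le> B |M x v|\<^sup>2\<close> almost everywhere, where \<open>M x\<close> is the
  adjoint phase matrix.  A countable dense set of vectors yields one exceptional null set for all \<open>v\<close>, and
  a matrix bounded below has a determinant bounded below.
\<close>
lemma det_bound_of_frame_spectrum:
  assumes \<Lambda>: "\<Lambda> \<subseteq> dual_group G" and frame: "frame_spectrum \<nu> \<Lambda>"
    and frame': "frame_spectrum \<mu> (translates_union t \<Lambda>)"
  shows "\<exists>\<epsilon>>0. AE x in \<nu>. \<epsilon> \<le> cmod (tiling_det G X t x)"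
proof -
  obtain A B where AB: "0 < A" "A \<le> B" and bounds: "\<And>g. square_integrable \<nu> g \<Longrightarrow>
      (\<lambda>l. (cmod (fourier_coeff \<nu> g l))\<^sup>2) summable_on \<Lambda> \<and>
      A * (LINT x|\<nu>. (cmod (g x))\<^sup>2) \<le> (\<Sum>\<^sub>\<infinity>l\<in>\<Lambda>. (cmod (fourier_coeff \<nu> g l))\<^sup>2) \<and>
      (\<Sum>\<^sub>\<infinity>l\<in>\<Lambda>. (cmod (fourier_coeff \<nu> g l))\<^sup>2) \<le> B * (LINT x|\<nu>. (cmod (g x))\<^sup>2)"
    using frame unfolding frame_spectrum_def by blast
  obtain a where a: "0 < a" and lower: "\<And>f. square_integrable \<mu> f \<Longrightarrow>
      a * (LINT y|\<mu>. (cmod (f y))\<^sup>2)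
        \<le> (\<Sum>\<^sub>\<infinity>l\<in>translates_union t \<Lambda>. (cmod (fourier_coeff \<mu> f l))\<^sup>2)"
    using frame' unfolding frame_spectrum_def by blast
  define M where "M x = adjoint_matrix (phase t x)" for x
  have energy: "a * (LINT x|\<nu>. (norm (fibre f x))\<^sup>2) \<le> B * (LINT x|\<nu>. (norm (analysis t f x))\<^sup>2)"
    if f: "square_integrable \<mu> f" for f
    using lower[OF f] frame_sum_bounds(2)[OF \<Lambda> f bounds, of t] by (simp add: fibre_square(2)[OF f])
  have [measurable]: "coset_rep G D \<in> borel_measurable borel"
    by (rule coset_rep_measurable[OF G D])
  have vector: "AE x in \<nu>. a * (norm v)\<^sup>2 \<le> B * (norm (M x *v v))\<^sup>2" for v
  proof -
    have m [measurable]: "(\<lambda>x. (norm (M x *v v))\<^sup>2) \<in> borel_measurable \<nu>"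
      unfolding norm_vec_sq M_def adjoint_matrix_def phase_def matrix_vector_mult_def by simp
    \<comment> \<open>The bad set; the aim is to show that it is null by testing on a function living over it.\<close>
    define E where "E = {x. B * (norm (M x *v v))\<^sup>2 < a * (norm v)\<^sup>2}"
    have "E = {x \<in> space \<nu>. B * (norm (M x *v v))\<^sup>2 < a * (norm v)\<^sup>2}"
      by (simp add: E_def space_nu)
    also have "\<dots> \<in> sets \<nu>" by measurable
    finally have E [measurable]: "E \<in> sets borel" by (simp add: sets_nu)
    define f where "f y = (\<Sum>k\<in>UNIV. v $ k * indicator (X k) y) * indicator E (coset_rep G D y)" for y
    have mf [measurable]: "f \<in> borel_measurable borel"
      unfolding f_def by measurable
    have f: "square_integrable \<mu> f"
      unfolding square_integrable_def
    proof
      show "f \<in> borel_measurable \<mu>" by (simp add: measurable_cong_sets[OF sets_mu refl])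
      show "integrable \<mu> (\<lambda>y. (cmod (f y))\<^sup>2)"
      proof (rule finite_measure.integrable_const_bound[OF finite_mu])
        have "cmod (f y) \<le> (\<Sum>k\<in>UNIV. cmod (v $ k)) * 1" for y
          unfolding f_def norm_mult
          by (intro mult_mono sum_norm_le sum_nonneg) (auto simp: norm_mult indicator_def)
        then show "AE y in \<mu>. norm ((cmod (f y))\<^sup>2) \<le> ((\<Sum>k\<in>UNIV. cmod (v $ k)) * 1)\<^sup>2"
          by (intro AE_I2) (simp add: power_mono)
        show "(\<lambda>y. (cmod (f y))\<^sup>2) \<in> borel_measurable \<mu>" by measurable
      qed
    qed
    have "AE x in \<nu>. \<forall>j k. j \<noteq> k \<longrightarrow> place j x \<notin> X k"
      by (simp add: eventually_all_finite place_disjoint)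
    with AE_S have fib: "AE x in \<nu>. fibre f x = indicator E x *s v"
    proof eventually_elim
      case (elim x)
      have "place j x \<in> X k \<longleftrightarrow> j = k" for j k
        using elim place_mem_X by blast
      moreover have "coset_rep G D (place j x) = x" for j
        using elim SD by (intro coset_rep_place) auto
      ultimately have "fibre f x $ j = (indicator E x *s v) $ j" for j
        by (simp add: fibre_def f_def indicator_def if_distrib[of "\<lambda>r. _ * r"] cong: if_cong)
      then show ?case by (simp add: vec_eq_iff)
    qed
    have "AE x in \<nu>. (norm (fibre f x))\<^sup>2 = indicator E x * (norm v)\<^sup>2 \<and>
        (norm (analysis t f x))\<^sup>2 = indicator E x * (norm (M x *v v))\<^sup>2"
      using fib by eventually_elim (simp add: analysis_def M_def indicator_def)
    then have fib_sq: "AE x in \<nu>. (norm (fibre f x))\<^sup>2 = indicator E x * (norm v)\<^sup>2"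
      and an_sq: "AE x in \<nu>. (norm (analysis t f x))\<^sup>2 = indicator E x * (norm (M x *v v))\<^sup>2"
      by (simp_all add: AE_conj_iff)
    note fsq = fibre_square(1)[OF f] and asq = analysis_square(2)[OF f, of t]
    have m1: "(\<lambda>x. indicator E x * (norm v)\<^sup>2) \<in> borel_measurable \<nu>"
      and m2: "(\<lambda>x. indicator E x * (norm (M x *v v))\<^sup>2) \<in> borel_measurable \<nu>"
      by measurable
    have i1: "integrable \<nu> (\<lambda>x. indicator E x * (norm v)\<^sup>2)"
      by (rule integrable_cong_AE_imp[OF fsq m1 fib_sq])
    have i2: "integrable \<nu> (\<lambda>x. indicator E x * (norm (M x *v v))\<^sup>2)"
      by (rule integrable_cong_AE_imp[OF asq m2 an_sq])
    have e1: "(LINT x|\<nu>. (norm (fibre f x))\<^sup>2) = (LINT x|\<nu>. indicator E x * (norm v)\<^sup>2)"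
      by (rule integral_cong_AE[OF borel_measurable_integrable[OF fsq] m1 fib_sq])
    have e2: "(LINT x|\<nu>. (norm (analysis t f x))\<^sup>2) = (LINT x|\<nu>. indicator E x * (norm (M x *v v))\<^sup>2)"
      by (rule integral_cong_AE[OF borel_measurable_integrable[OF asq] m2 an_sq])
    \<comment> \<open>Strictly positive on \<open>E\<close> and zero off \<open>E\<close>.\<close>
    let ?gap = "\<lambda>x. a * (indicator E x * (norm v)\<^sup>2) - B * (indicator E x * (norm (M x *v v))\<^sup>2)"
    have int: "integrable \<nu> ?gap" using i1 i2 by simp
    have nonneg: "0 \<le> ?gap x" for x by (auto simp: indicator_def E_def)
    have "(LINT x|\<nu>. ?gap x) \<le> 0"
      using energy[OF f] i1 i2 by (simp add: e1 e2)
    moreover have "0 \<le> (LINT x|\<nu>. ?gap x)" by (rule Bochner_Integration.integral_nonneg) (rule nonneg)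
    ultimately have "AE x in \<nu>. ?gap x = 0"
      using integral_nonneg_eq_0_iff_AE[OF int] nonneg by auto
    then show ?thesis
      by eventually_elim (auto simp: indicator_def E_def split: if_splits)
  qed
  obtain Z :: "(complex ^ 'n) set" where Z: "countable Z" "\<And>U. open U \<Longrightarrow> U \<noteq> {} \<Longrightarrow> \<exists>v\<in>Z. v \<in> U"
    using countable_dense_exists by blast
  have "AE x in \<nu>. \<forall>v\<in>Z. a * (norm v)\<^sup>2 \<le> B * (norm (M x *v v))\<^sup>2"
    using Z(1) vector by (simp add: AE_ball_countable)
  then have all: "AE x in \<nu>. \<forall>v. a * (norm v)\<^sup>2 \<le> B * (norm (M x *v v))\<^sup>2"
    by eventually_elim (use norm_matrix_vector_ge_of_dense[OF Z(2)] in blast)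
  define c where "c = sqrt (a / B)"
  have c: "0 < c" using a AB by (simp add: c_def)
  show ?thesis
  proof (intro exI conjI)
    show "0 < c ^ CARD('n) / fact CARD('n)" using c by simp
    show "AE x in \<nu>. c ^ CARD('n) / fact CARD('n) \<le> cmod (tiling_det G X t x)"
      using AE_S all
    proof eventually_elim
      case (elim x)
      have "c * norm v \<le> norm (M x *v v)" for v
      proof (rule power2_le_imp_le)
        have "a / B * (norm v)\<^sup>2 \<le> (norm (M x *v v))\<^sup>2"
          using elim(2) AB by (simp add: field_simps)
        then show "(c * norm v)\<^sup>2 \<le> (norm (M x *v v))\<^sup>2"
          using a AB by (simp add: c_def power_mult_distrib)
      qed simp
      then have "c ^ CARD('n) / fact CARD('n) \<le> cmod (det (M x))"
        by (rule det_lower_bound[OF c])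
      then show ?case
        using elim(1) by (simp add: M_def norm_det_adjoint norm_det_phase)
    qed
  qed
qed

end

section \<open>The equivalence\<close>

theorem theorem2p7:
  fixes G D S :: "(real ^ 'd) set"
    and \<nu> \<mu> :: "(real ^ 'd) measure"
    and \<mu>s :: "'n::finite \<Rightarrow> (real ^ 'd) measure"
    and X :: "'n \<Rightarrow> (real ^ 'd) set"
    and t :: "'n \<Rightarrow> real ^ 'd"
  assumes "closed_additive_subgroup G"
    and "fundamental_domain G D"
    and "finite_borel_measure \<nu>"
    and "essential_support \<nu> S"
    and "S \<subseteq> D"
    and "multi_tiling_measure G D \<nu> S \<mu>s X \<mu>"
    and "\<exists>\<Lambda>. \<Lambda> \<subseteq> dual_group G \<and> riesz_spectrum \<nu> \<Lambda>"
  shows "((\<exists>\<epsilon>>0. AE x in \<nu>. cmod (tiling_det G X t x) \<ge> \<epsilon>) \<longleftrightarrow>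
          (\<forall>\<Lambda>. \<Lambda> \<subseteq> dual_group G \<and> frame_spectrum \<nu> \<Lambda> \<longrightarrow>
               frame_spectrum \<mu> (translates_union t \<Lambda>))) \<and>
         ((\<forall>\<Lambda>. \<Lambda> \<subseteq> dual_group G \<and> frame_spectrum \<nu> \<Lambda> \<longrightarrow>
               frame_spectrum \<mu> (translates_union t \<Lambda>)) \<longleftrightarrow>
          (\<forall>\<Lambda>. \<Lambda> \<subseteq> dual_group G \<and> riesz_spectrum \<nu> \<Lambda> \<longrightarrow>
               riesz_spectrum \<mu> (translates_union t \<Lambda>)))"
    (is "(?det \<longleftrightarrow> ?frame) \<and> (?frame \<longleftrightarrow> ?riesz)")
proof -
  interpret multi_tiling G D S \<nu> \<mu> \<mu>s X
    using assms(1-6) by (rule multi_tiling.intro)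
  obtain \<Lambda>\<^sub>0 where \<Lambda>\<^sub>0: "\<Lambda>\<^sub>0 \<subseteq> dual_group G" "riesz_spectrum \<nu> \<Lambda>\<^sub>0"
    using assms(7) by blast
  have det_frame: ?frame and det_riesz: ?riesz if det: ?det
  proof -
    obtain \<epsilon> where \<epsilon>: "0 < \<epsilon>" "AE x in \<nu>. \<epsilon> \<le> cmod (tiling_det G X t x)"
      using det by blast
    show ?frame
      using frame_spectrum_translates[OF _ \<epsilon>] by simp
    show ?riesz
      using riesz_spectrum_translates[OF _ \<epsilon>] by simp
  qed
  have det_of_frame: ?det if "frame_spectrum \<mu> (translates_union t \<Lambda>\<^sub>0)"
    by (rule det_bound_of_frame_spectrum[OF \<Lambda>\<^sub>0(1) riesz_imp_frame[OF \<Lambda>\<^sub>0(2)] that])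
  have frame_det: ?det if ?frame
    by (rule det_of_frame) (simp add: that \<Lambda>\<^sub>0(1) riesz_imp_frame[OF \<Lambda>\<^sub>0(2)])
  have riesz_det: ?det if ?riesz
    by (rule det_of_frame, rule riesz_imp_frame) (simp add: that \<Lambda>\<^sub>0)
  show ?thesis
  proof (rule conjI; rule iffI)
    show ?frame if ?det using that by (rule det_frame)
    show ?det if ?frame using that by (rule frame_det)
    show ?riesz if ?frame by (rule det_riesz[OF frame_det[OF that]])
    show ?frame if ?riesz by (rule det_frame[OF riesz_det[OF that]])
  qed
qed

end
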